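(* Let $p,q$ be finite probability vectors, and denote by $u$ the uniform distribution on $\operatorname{supp}p\cup\operatorname{supp}q$. If $$D_\alpha(p\|u)>D_\alpha(q\|u),$$ $$D_\alpha(u\|p)>D_\alpha(u\|q)$$ for all $\alpha\in[\tfrac12,\infty]$, then, for all sufficiently large $n\in\mathbb N$, $p^{\otimes n}$ majorizes $q^{\otimes n}$.
   Context: Finite probability vectors $p=(p_1,\ldots,p_n)$ of different lengths are identified with vectors of a common length by padding with zeros, and supports are subsets of $\mathbb N$. $u$ is the vector with entries $1/|I|$ on $I=\operatorname{supp}p\cup\operatorname{supp}q$ and $0$ elsewhere. $\otimes$ is the Kronecker product. A probability vector $p$ majorizes $q$ if (after padding to the same length) there is a bistochastic matrix $T$ (non-negative entries, all rows and columns summing to $1$) with $Tp=q$; equivalently, $\sum_{i=1}^kp_i^\downarrow\geq\sum_{i=1}^kq_i^\downarrow$ for all $k$, where $\downarrow$ denotes the non-increasing rearrangement. The Rényi divergences of probability vectors $a,b$ are, for $\alpha>0$ (with $\log$ to a fixed base greater than $1$ and $0\log0:=0$): $D_\alpha(a\|b)=\frac{1}{\alpha-1}\log\sum_i a_i^\alpha b_i^{1-\alpha}$ if $\alpha\in(0,1)$ and $\operatorname{supp}a\cap\operatorname{supp}b\neq\emptyset$; $D_1(a\|b)=\sum_i a_i\log\frac{a_i}{b_i}$ if $\operatorname{supp}a\subseteq\operatorname{supp}b$; $D_\alpha(a\|b)=\frac{1}{\alpha-1}\log\sum_i a_i^\alpha b_i^{1-\alpha}$ if $\alpha\in(1,\infty)$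 and $\operatorname{supp}a\subseteq\operatorname{supp}b$; $D_\infty(a\|b)=\max_{i\in\operatorname{supp}b}\log\frac{a_i}{b_i}$ if $\operatorname{supp}a\subseteq\operatorname{supp}b$; and $D_\alpha(a\|b)=\infty$ in all other cases. (Sums are effectively over the indices where the terms are non-zero.) A strict inequality whose left-hand side is $\infty$ and whose right-hand side is finite is regarded as holding. *)

theory Defs
  imports Complex_Main "HOL-Library.Extended_Real" "Jordan_Normal_Form.Matrix"
begin

text \<open>Zero-padding: entries beyond the dimension of a vector are read as \<open>0\<close>.\<close>

definition entry :: "real vec \<Rightarrow> nat \<Rightarrow> real" where
  "entry v i = (if i < dim_vec v then v $ i else 0)"

definition pad :: "nat \<Rightarrow> real vec \<Rightarrow> real vec" where
  "pad N v = vec N (entry v)"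

definition vsupp :: "real vec \<Rightarrow> nat set" where
  "vsupp v = {i. entry v i \<noteq> 0}"

definition prob_vec :: "real vec \<Rightarrow> bool" where
  "prob_vec v \<longleftrightarrow> (\<forall>i<dim_vec v. 0 \<le> v $ i) \<and> (\<Sum>i<dim_vec v. v $ i) = 1"

definition uniform_vec :: "nat \<Rightarrow> nat set \<Rightarrow> real vec" where
  "uniform_vec N I = vec N (\<lambda>i. if i \<in> I then 1 / real (card I) else 0)"

definition kron :: "real vec \<Rightarrow> real vec \<Rightarrow> real vec" where
  "kron v w = vec (dim_vec v * dim_vec w) (\<lambda>i. v $ (i div dim_vec w) * w $ (i mod dim_vec w))"

primrec kron_power :: "real vec \<Rightarrow> nat \<Rightarrow> real vec" where
  "kron_power v 0 = vec 1 (\<lambda>_. 1)"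
| "kron_power v (Suc n) = kron v (kron_power v n)"

definition bistochastic :: "nat \<Rightarrow> real mat \<Rightarrow> bool" where
  "bistochastic N T \<longleftrightarrow> T \<in> carrier_mat N N
     \<and> (\<forall>i<N. \<forall>j<N. 0 \<le> T $$ (i, j))
     \<and> (\<forall>i<N. (\<Sum>j<N. T $$ (i, j)) = 1)
     \<and> (\<forall>j<N. (\<Sum>i<N. T $$ (i, j)) = 1)"

definition majorizes :: "real vec \<Rightarrow> real vec \<Rightarrow> bool" where
  "majorizes v w \<longleftrightarrow> (let N = max (dim_vec v) (dim_vec w) in
     \<exists>T. bistochastic N T \<and> T *\<^sub>v pad N v = pad N w)"

text \<open>Logarithm with value \<open>-\<infinity>\<close> at \<open>0\<close> (the library's \<^const>\<open>log\<close> gives \<open>0\<close> there),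
  needed for the entries with \<open>a\<^sub>i = 0\<close> in the maximum defining \<open>D\<^sub>\<infinity>\<close>.\<close>

definition elog :: "real \<Rightarrow> real \<Rightarrow> ereal" where
  "elog base x = (if x = 0 then -\<infinity> else ereal (log base x))"

text \<open>Since \<open>0 powr s = 0\<close> for every \<open>s\<close>, in each finite case the terms at indices outside
  \<open>supp a \<inter> supp b\<close> vanish.\<close>

definition renyi_div :: "real \<Rightarrow> ereal \<Rightarrow> real vec \<Rightarrow> real vec \<Rightarrow> ereal" where
  "renyi_div base \<alpha> a b =
    (let N = max (dim_vec a) (dim_vec b); r = real_of_ereal \<alpha> in
     if 0 < \<alpha> \<and> \<alpha> < 1 \<and> vsupp a \<inter> vsupp b \<noteq> {} then
       ereal (1 / (r - 1) * log base (\<Sum>i<N. entry a i powr r * entry b i powr (1 - r)))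
     else if \<alpha> = 1 \<and> vsupp a \<subseteq> vsupp b then
       ereal (\<Sum>i<N. entry a i * log base (entry a i / entry b i))
     else if 1 < \<alpha> \<and> \<alpha> < \<infinity> \<and> vsupp a \<subseteq> vsupp b then
       ereal (1 / (r - 1) * log base (\<Sum>i<N. entry a i powr r * entry b i powr (1 - r)))
     else if \<alpha> = \<infinity> \<and> vsupp a \<subseteq> vsupp b then
       Max ((\<lambda>i. elog base (entry a i / entry b i)) ` vsupp b)
     else \<infinity>)"

end

theory Submission
  imports Defs
begin

text \<open>By the Hardy--Littlewood--Polya criterion, \<open>P = p\<^sup>\<otimes>\<^sup>n\<close> majorizes \<open>Q = q\<^sup>\<otimes>\<^sup>n\<close> iff
  \<open>\<Sum>(P - t)\<^sup>+ \<ge> \<Sum>(Q - t)\<^sup>+\<close> for all \<open>t = e\<^sup>n\<^sup>\<tau>\<close>. The hypotheses say that the power sums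
  \<open>M\<^sub>p(s) = \<Sum>p\<^sub>i\<^sup>s\<close> and \<open>M\<^sub>q(s)\<close> are strictly ordered: \<open>M\<^sub>p > M\<^sub>q\<close> for \<open>s > 1\<close> and (if \<open>p\<close> has full
  support) for \<open>s < 0\<close>, \<open>M\<^sub>p < M\<^sub>q\<close> for \<open>0 < s < 1\<close>, together with the limiting conditions at
  \<open>s = 0, 1, \<plusminus>\<infinity>\<close>. Equivalent forms of the criterion are \<open>\<Sum>min(P, t) \<le> \<Sum>min(Q, t)\<close> and
  \<open>\<Sum>(t - P)\<^sup>+ \<ge> \<Sum>(t - Q)\<^sup>+\<close>. For \<open>\<tau>\<close> above the mean of \<open>ln q\<close> under \<open>q\<close>, below the mean of
  \<open>ln q\<close> under the uniform distribution, and between these two, the smaller side of the first,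
  third and second form, respectively, is bounded above by Chernoff's estimate and the larger side is bounded
  below by Cramer's (the weak law under an exponentially tilted measure). The strict ordering of the
  power sums separates the two exponents near each \<open>\<tau>\<close>, and compactness of the interval
  \<open>[ln (min q), ln (max q)]\<close>, outside of which the inequality is trivial, makes \<open>n\<close> uniform.\<close>

section \<open>Majorization\<close>

text \<open>The relation \<open>y = T x\<close> for a bistochastic \<open>T\<close>, with vectors
  and matrices as plain functions on the indices below \<open>N\<close>, so that products and
  mixtures of matrices carry no dimension conditions.\<close>

definition bistochastic_image :: "nat \<Rightarrow> (nat \<Rightarrow> real) \<Rightarrow> (nat \<Rightarrow> real) \<Rightarrow> bool" where
  "bistochastic_image N x y \<longleftrightarrow> (\<exists>T. (\<forall>i<N. \<forall>j<N. 0 \<le> T i j) \<and> (\<forall>i<N. (\<Sum>j<N. T i j) = 1)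
     \<and> (\<forall>j<N. (\<Sum>i<N. T i j) = 1) \<and> (\<forall>i<N. y i = (\<Sum>j<N. T i j * x j)))"

lemma bistochastic_image_trans:
  assumes "bistochastic_image N x y" "bistochastic_image N y z"
  shows "bistochastic_image N x z"
proof -
  obtain S where S: "\<forall>i<N. \<forall>j<N. 0 \<le> S i j" "\<forall>i<N. (\<Sum>j<N. S i j) = 1"
      "\<forall>j<N. (\<Sum>i<N. S i j) = 1" "\<forall>i<N. y i = (\<Sum>j<N. S i j * x j)"
    using assms(1) unfolding bistochastic_image_def by blast
  obtain T where T: "\<forall>i<N. \<forall>j<N. 0 \<le> T i j" "\<forall>i<N. (\<Sum>j<N. T i j) = 1"
      "\<forall>j<N. (\<Sum>i<N. T i j) = 1" "\<forall>i<N. z i = (\<Sum>j<N. T i j * y j)"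
    using assms(2) unfolding bistochastic_image_def by blast
  define R where "R i j = (\<Sum>k<N. T i k * S k j)" for i j
  have "(\<Sum>j<N. R i j) = 1" if "i < N" for i
  proof -
    have "(\<Sum>j<N. R i j) = (\<Sum>k<N. T i k * (\<Sum>j<N. S k j))"
      unfolding R_def sum_distrib_left by (rule sum.swap)
    then show ?thesis using S(2) T(2) that by simp
  qed
  moreover have "(\<Sum>i<N. R i j) = 1" if "j < N" for j
  proof -
    have "(\<Sum>i<N. R i j) = (\<Sum>k<N. (\<Sum>i<N. T i k) * S k j)"
      unfolding R_def sum_distrib_right by (rule sum.swap)
    then show ?thesis using S(3) T(3) that by simp
  qed
  moreover have "z i = (\<Sum>j<N. R i j * x j)" if "i < N" for i
  proof -
    have "z i = (\<Sum>k<N. \<Sum>j<N. T i k * S k j * x j)"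
      using T(4) S(4) that by (simp add: sum_distrib_left mult.assoc)
    also have "\<dots> = (\<Sum>j<N. R i j * x j)"
      unfolding R_def sum_distrib_right by (rule sum.swap)
    finally show ?thesis .
  qed
  moreover have "0 \<le> R i j" if "i < N" "j < N" for i j
    unfolding R_def using S(1) T(1) that by (auto intro!: sum_nonneg)
  ultimately show ?thesis unfolding bistochastic_image_def by (intro exI[of _ R]) blast
qed

lemma bistochastic_image_permute:
  assumes "\<sigma> permutes {..<N}"
  shows "bistochastic_image N x (\<lambda>i. x (\<sigma> i))"
proof -
  define T :: "nat \<Rightarrow> nat \<Rightarrow> real" where "T i j = (if j = \<sigma> i then 1 else 0)" for i j
  have "\<sigma> i < N" if "i < N" for i
    using permutes_in_image[OF assms, of i] that by simp
  then have "(\<Sum>j<N. T i j) = 1" "x (\<sigma> i) = (\<Sum>j<N. T i j * x j)" if "i < N" for i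
    using that by (simp_all add: T_def if_distrib[of "\<lambda>c. c * _"] cong: if_cong)
  moreover have "(\<Sum>i<N. T i j) = 1" if "j < N" for j
  proof -
    have "(\<Sum>i<N. T i j) = (\<Sum>i<N. if j = i then 1 else 0)"
      unfolding T_def by (subst (2) sum.permute[OF assms]) simp
    then show ?thesis using that by simp
  qed
  ultimately show ?thesis
    unfolding bistochastic_image_def by (intro exI[of _ T]) (auto simp: T_def)
qed

lemma bistochastic_image_convex:
  assumes "bistochastic_image N x y" "bistochastic_image N x z" "0 \<le> c" "c \<le> 1"
  shows "bistochastic_image N x (\<lambda>i. (1 - c) * y i + c * z i)"
proof -
  obtain S where S: "\<forall>i<N. \<forall>j<N. 0 \<le> S i j" "\<forall>i<N. (\<Sum>j<N. S i j) = 1"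
      "\<forall>j<N. (\<Sum>i<N. S i j) = 1" "\<forall>i<N. y i = (\<Sum>j<N. S i j * x j)"
    using assms(1) unfolding bistochastic_image_def by blast
  obtain T where T: "\<forall>i<N. \<forall>j<N. 0 \<le> T i j" "\<forall>i<N. (\<Sum>j<N. T i j) = 1"
      "\<forall>j<N. (\<Sum>i<N. T i j) = 1" "\<forall>i<N. z i = (\<Sum>j<N. T i j * x j)"
    using assms(2) unfolding bistochastic_image_def by blast
  show ?thesis unfolding bistochastic_image_def
    using S T assms(3,4)
    by (intro exI[of _ "\<lambda>i j. (1 - c) * S i j + c * T i j"])
       (auto simp: sum.distrib distrib_right mult.assoc simp flip: sum_distrib_left)
qed

text \<open>Muirhead's transfer argument: while \<open>x\<close> and \<open>y\<close> differ, moving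
  an amount \<open>d\<close> from a surplus position to a later deficit position is a bistochastic
  step that preserves the hypotheses and makes one more coordinate agree. Only \<open>y\<close> is
  assumed decreasing, so the intermediate vectors may be unordered.\<close>

lemma bistochastic_image_if_partial_sums_le:
  assumes dec: "\<And>i j. i \<le> j \<Longrightarrow> j < N \<Longrightarrow> y j \<le> y i"
    and le: "\<And>k. k \<le> N \<Longrightarrow> (\<Sum>i<k. y i) \<le> (\<Sum>i<k. x i)"
    and eq: "(\<Sum>i<N. y i) = (\<Sum>i<N. x i)"
  shows "bistochastic_image N x y"
  using le eq
proof (induction "card {i. i < N \<and> x i \<noteq> y i}" arbitrary: x rule: less_induct)
  case less
  show ?case
  proof (cases "\<exists>k<N. x k < y k")
    case False
    then have "\<forall>i\<in>{..<N}. 0 \<le> x i - y i" "(\<Sum>i<N. x i - y i) = 0"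
      using less.prems(2) by (fastforce simp: sum_subtractf not_less)+
    then have "x i = y i" if "i < N" for i
      using sum_nonneg_eq_0_iff[of "{..<N}" "\<lambda>i. x i - y i"] that by auto
    moreover have "bistochastic_image N x x" using bistochastic_image_permute[OF permutes_id] by simp
    ultimately show ?thesis unfolding bistochastic_image_def by simp
  next
    case True
    \<comment> \<open>The first deficit. All earlier coordinates satisfy
      \<open>y i \<le> x i\<close>, and the partial sum that includes \<open>k\<close> forces a
      strict surplus at some \<open>j < k\<close>.\<close>
    define k where "k = (LEAST k. k < N \<and> x k < y k)"
    have k: "k < N" "x k < y k"
      using LeastI_ex[OF True] unfolding k_def by auto
    have lk: "y i \<le> x i" if "i < k" for i
      using not_less_Least[of i "\<lambda>k. k < N \<and> x k < y k"] that k(1) unfolding k_def[symmetric] by auto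
    have "\<exists>j<k. y j < x j"
    proof (rule ccontr)
      assume "\<not> ?thesis"
      then have "(\<Sum>i<k. x i) \<le> (\<Sum>i<k. y i)" by (intro sum_mono) (metis lessThan_iff not_less)
      then have "(\<Sum>i<Suc k. x i) < (\<Sum>i<Suc k. y i)" using k by simp
      then show False using less.prems(1)[of "Suc k"] k(1) by simp
    qed
    then obtain j where j: "j < k" "y j < x j" by blast
    \<comment> \<open>The largest amount that overshoots neither target, so that position
      \<open>j\<close> or position \<open>k\<close> becomes exact.\<close>
    define d where "d = min (x j - y j) (y k - x k)"
    define x' where "x' = x(j := x j - d, k := x k + d)"
    have d: "0 < d" "d \<le> x j - y j" "d \<le> y k - x k" using j k by (auto simp: d_def)
    have jk: "y k \<le> y j" using dec[of j k] j k by simp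
    \<comment> \<open>The transfer is the mixture, with weight \<open>c\<close>, of the identity and
      the transposition of \<open>j\<close> and \<open>k\<close>. Since
      \<open>y k \<le> y j\<close>, the amount \<open>d\<close> is at most
      \<open>x j - x k\<close>.\<close>
    define c where "c = d / (x j - x k)"
    have c: "0 \<le> c" "c \<le> 1" "c * (x j - x k) = d" using d jk k by (auto simp: c_def)
    have "bistochastic_image N x (\<lambda>i. (1 - c) * x (id i) + c * x (transpose j k i))"
      using c j k by (intro bistochastic_image_convex bistochastic_image_permute permutes_id permutes_swap_id) auto
    also have "(\<lambda>i. (1 - c) * x (id i) + c * x (transpose j k i)) = x'"
      using c(3) j unfolding x'_def by (auto simp: fun_eq_iff transpose_def algebra_simps)
    finally have 1: "bistochastic_image N x x'" .
    have sums: "(\<Sum>i<m. x' i) = (\<Sum>i<m. x i) - (if j < m then d else 0) + (if k < m then d else 0)" for m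
    proof -
      have "(\<Sum>i<m. x' i) = (\<Sum>i<m. x i + (if i = j then - d else 0) + (if i = k then d else 0))"
        using j by (intro sum.cong) (auto simp: x'_def)
      then show ?thesis by (auto simp: sum.distrib)
    qed
    \<comment> \<open>Only the partial sums with \<open>j < m \<le> k\<close> drop by
      \<open>d\<close>. Their differences \<open>x i - y i\<close> are all non-negative, and the one
      at \<open>j\<close> alone is at least \<open>d\<close>.\<close>
    have "(\<Sum>i<m. y i) \<le> (\<Sum>i<m. x' i)" if m: "m \<le> N" for m
    proof (cases "j < m \<and> m \<le> k")
      case True
      have "d \<le> x j - y j" by (rule d)
      also have "\<dots> \<le> (\<Sum>i<m. x i - y i)"
        using True lk by (intro member_le_sum) auto
      finally show ?thesis using True by (simp add: sums sum_subtractf)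
    next
      case False
      then show ?thesis using less.prems(1)[OF m] d by (auto simp: sums)
    qed
    moreover have "(\<Sum>i<N. y i) = (\<Sum>i<N. x' i)"
      using less.prems(2) j k by (simp add: sums)
    moreover have "card {i. i < N \<and> x' i \<noteq> y i} < card {i. i < N \<and> x i \<noteq> y i}"
    proof (rule psubset_card_mono)
      have "{i. i < N \<and> x' i \<noteq> y i} \<subseteq> {i. i < N \<and> x i \<noteq> y i}"
        using j k by (auto simp: x'_def split: if_splits)
      moreover have "x' j = y j \<or> x' k = y k" using j by (auto simp: x'_def d_def)
      ultimately show "{i. i < N \<and> x' i \<noteq> y i} \<subset> {i. i < N \<and> x i \<noteq> y i}"
        using j k by fastforce
    qed simp
    ultimately have "bistochastic_image N x' y" by (rule less.hyps[rotated])
    with 1 show ?thesis by (rule bistochastic_image_trans)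
  qed
qed

section \<open>The Hardy-Littlewood-Polya criterion in terms of hinge sums\<close>

lemma obtain_decreasing:
  fixes x :: "nat \<Rightarrow> real"
  obtains \<sigma> where "\<sigma> permutes {..<N}" "\<And>i j. i \<le> j \<Longrightarrow> j < N \<Longrightarrow> x (\<sigma> j) \<le> x (\<sigma> i)"
proof -
  define l where "l = rev (sort (map x [0..<N]))"
  have "mset l = mset (map x [0..<N])" by (simp add: l_def)
  then obtain \<sigma> where \<sigma>: "\<sigma> permutes {..<length (map x [0..<N])}" "permute_list \<sigma> (map x [0..<N]) = l"
    by (rule mset_eq_permutation)
  have "\<sigma> i < N" if "i < N" for i
    using permutes_in_image[OF \<sigma>(1), of i] that by simp
  then have nth: "l ! i = x (\<sigma> i)" if "i < N" for i
    using that \<sigma> by (auto simp: permute_list_nth simp flip: \<sigma>(2))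
  have "l ! j \<le> l ! i" if "i \<le> j" "j < N" for i j
  proof -
    have "sorted (rev l)" by (simp add: l_def)
    then show ?thesis using sorted_rev_nth_mono[of l i j] that by (simp add: l_def)
  qed
  then have "x (\<sigma> j) \<le> x (\<sigma> i)" if "i \<le> j" "j < N" for i j
    using nth[of i] nth[of j] that by force
  with \<sigma>(1) show ?thesis by (intro that[of \<sigma>]) simp_all
qed

text \<open>A sum of \<open>k\<close> entries of \<open>y\<close> is at most \<open>k * t\<close>
  plus the hinge sum of \<open>y\<close> at \<open>t\<close>, whatever \<open>t\<close> is. For the
  \<open>k\<close> largest entries of \<open>x\<close> a suitable \<open>t\<close> turns this into
  an equality.\<close>

lemma bistochastic_image_if_hinge_sums_le:
  assumes le: "\<And>t. (\<Sum>i<N. max 0 (y i - t)) \<le> (\<Sum>i<N. max 0 (x i - t))"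
    and eq: "(\<Sum>i<N. y i) = (\<Sum>i<N. x i)"
  shows "bistochastic_image N x y"
proof -
  obtain \<sigma> where \<sigma>: "\<sigma> permutes {..<N}" "\<And>i j. i \<le> j \<Longrightarrow> j < N \<Longrightarrow> x (\<sigma> j) \<le> x (\<sigma> i)"
    using obtain_decreasing[of N x] by metis
  obtain \<tau> where \<tau>: "\<tau> permutes {..<N}" "\<And>i j. i \<le> j \<Longrightarrow> j < N \<Longrightarrow> y (\<tau> j) \<le> y (\<tau> i)"
    using obtain_decreasing[of N y] by metis
  have perm: "(\<Sum>i<N. g (\<pi> i)) = (\<Sum>i<N. g i)" if "\<pi> permutes {..<N}" for \<pi> and g :: "nat \<Rightarrow> real"
    using sum.permute[OF that, of g] by (simp add: comp_def)
  have "(\<Sum>i<k. y (\<tau> i)) \<le> (\<Sum>i<k. x (\<sigma> i))" if k: "k \<le> N" for k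
  proof (cases k)
    case (Suc m)
    \<comment> \<open>The \<open>k\<close>-th largest entry, as sorted positions count from 0: the
      hinge is \<open>x - t\<close> on the first \<open>k\<close> sorted entries and 0 on the
      rest.\<close>
    define t where "t = x (\<sigma> m)"
    have "(\<Sum>i<k. y (\<tau> i)) \<le> (\<Sum>i<k. max 0 (y (\<tau> i) - t) + t)" by (intro sum_mono) simp
    also have "\<dots> = (\<Sum>i<k. max 0 (y (\<tau> i) - t)) + k * t" by (simp add: sum.distrib)
    also have "(\<Sum>i<k. max 0 (y (\<tau> i) - t)) \<le> (\<Sum>i<N. max 0 (y (\<tau> i) - t))"
      using k by (intro sum_mono2) auto
    also have "\<dots> \<le> (\<Sum>i<N. max 0 (x (\<sigma> i) - t))"
      using le[of t] perm[OF \<sigma>(1), of "\<lambda>i. max 0 (x i - t)"] perm[OF \<tau>(1), of "\<lambda>i. max 0 (y i - t)"]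
      by simp
    also have "\<dots> = (\<Sum>i<k. max 0 (x (\<sigma> i) - t))"
    proof (rule sum.mono_neutral_right)
      show "\<forall>i\<in>{..<N} - {..<k}. max 0 (x (\<sigma> i) - t) = 0"
        using \<sigma>(2)[of m] Suc unfolding t_def by auto
    qed (use k in auto)
    also have "\<dots> = (\<Sum>i<k. x (\<sigma> i) - t)"
      using \<sigma>(2)[of _ m] Suc k unfolding t_def by (intro sum.cong) auto
    finally show ?thesis by (simp add: sum_subtractf)
  qed simp
  moreover have "(\<Sum>i<N. y (\<tau> i)) = (\<Sum>i<N. x (\<sigma> i))"
    using eq perm[OF \<sigma>(1), of x] perm[OF \<tau>(1), of y] by simp
  ultimately have "bistochastic_image N (\<lambda>i. x (\<sigma> i)) (\<lambda>i. y (\<tau> i))"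
    using \<tau>(2) by (intro bistochastic_image_if_partial_sums_le)
  then have "bistochastic_image N x (\<lambda>i. y (\<tau> i))"
    by (rule bistochastic_image_trans[OF bistochastic_image_permute[OF \<sigma>(1)]])
  moreover have "bistochastic_image N (\<lambda>i. y (\<tau> i)) (\<lambda>i. y (\<tau> (inv_into UNIV \<tau> i)))"
    by (intro bistochastic_image_permute[where x = "\<lambda>i. y (\<tau> i)"] permutes_inv \<tau>(1))
  ultimately show ?thesis
    using bistochastic_image_trans by (simp add: permutes_inverses(1)[OF \<tau>(1)])
qed

lemma majorizes_if_hinge_sums_le:
  assumes N: "N = max (dim_vec v) (dim_vec w)"
    and le: "\<And>t. (\<Sum>i<N. max 0 (entry w i - t)) \<le> (\<Sum>i<N. max 0 (entry v i - t))"
    and eq: "(\<Sum>i<N. entry w i) = (\<Sum>i<N. entry v i)"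
  shows "majorizes v w"
proof -
  obtain T where T: "\<forall>i<N. \<forall>j<N. 0 \<le> T i j" "\<forall>i<N. (\<Sum>j<N. T i j) = 1"
      "\<forall>j<N. (\<Sum>i<N. T i j) = 1" "\<forall>i<N. entry w i = (\<Sum>j<N. T i j * entry v j)"
    using bistochastic_image_if_hinge_sums_le[OF le eq] unfolding bistochastic_image_def by blast
  define A where "A = mat N N (\<lambda>(i, j). T i j)"
  have "bistochastic N A" using T by (simp add: bistochastic_def A_def)
  moreover have "A *\<^sub>v pad N v = pad N w"
    using T(4) by (intro eq_vecI) (auto simp: A_def pad_def scalar_prod_def atLeast0LessThan intro!: sum.cong)
  ultimately show ?thesis unfolding majorizes_def Let_def N[symmetric] by blast
qed

section \<open>Large deviation estimates\<close>

definition tuples :: "'a set \<Rightarrow> nat \<Rightarrow> 'a list set" where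
  "tuples I n = {xs. set xs \<subseteq> I \<and> length xs = n}"

lemma tuples_0 [simp]: "tuples I 0 = {[]}"
  by (auto simp: tuples_def)

lemma finite_tuples [simp]: "finite I \<Longrightarrow> finite (tuples I n)"
  by (simp add: tuples_def finite_lists_length_eq)

lemma sum_tuples_Suc:
  "(\<Sum>xs\<in>tuples I (Suc n). f xs) = (\<Sum>i\<in>I. \<Sum>xs\<in>tuples I n. f (i # xs))"
proof -
  have "tuples I (Suc n) = (\<lambda>(i, xs). i # xs) ` (I \<times> tuples I n)"
    by (auto simp: tuples_def length_Suc_conv image_iff)
  then have "(\<Sum>xs\<in>tuples I (Suc n). f xs) = (\<Sum>(i, xs)\<in>I \<times> tuples I n. f (i # xs))"
    by (simp add: sum.reindex inj_on_def case_prod_unfold)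
  then show ?thesis by (simp add: sum.cartesian_product)
qed

abbreviation pr :: "('a \<Rightarrow> real) \<Rightarrow> 'a list \<Rightarrow> real" where
  "pr c xs \<equiv> prod_list (map c xs)"

abbreviation sm :: "('a \<Rightarrow> real) \<Rightarrow> 'a list \<Rightarrow> real" where
  "sm v xs \<equiv> sum_list (map v xs)"

lemma pr_nonneg: "(\<And>i. i \<in> I \<Longrightarrow> 0 \<le> c i) \<Longrightarrow> xs \<in> tuples I n \<Longrightarrow> 0 \<le> pr c xs"
  by (auto simp: tuples_def subset_eq intro!: prod_list_nonneg)

lemma pr_exp_tilt: "pr (\<lambda>i. b i * exp (s * u i)) xs = pr b xs * exp (s * sm u xs)"
  by (induction xs) (simp_all add: exp_add distrib_left)

lemma sum_pr_tuples: "(\<Sum>xs\<in>tuples I n. pr c xs) = (\<Sum>i\<in>I. c i) ^ n"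
  by (induction n) (simp_all add: sum_tuples_Suc flip: sum_distrib_left sum_distrib_right)

text \<open>Variance of a sum of independent centred terms under weights of arbitrary total mass:
  the mixed terms vanish by centring. The extra total mass on the left avoids the exponent
  \<open>n - 1\<close> on the right.\<close>

lemma sum_pr_sm_square_tuples:
  assumes "(\<Sum>i\<in>I. c i * v i) = 0"
  shows "(\<Sum>i\<in>I. c i) * (\<Sum>xs\<in>tuples I n. pr c xs * (sm v xs)\<^sup>2)
    = n * (\<Sum>i\<in>I. c i * (v i)\<^sup>2) * (\<Sum>i\<in>I. c i) ^ n"
proof (induction n)
  case (Suc n)
  have "(\<Sum>xs\<in>tuples I (Suc n). pr c xs * (sm v xs)\<^sup>2)
      = (\<Sum>i\<in>I. c i * (v i)\<^sup>2) * (\<Sum>xs\<in>tuples I n. pr c xs)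
        + 2 * ((\<Sum>i\<in>I. c i * v i) * (\<Sum>xs\<in>tuples I n. pr c xs * sm v xs))
        + (\<Sum>i\<in>I. c i) * (\<Sum>xs\<in>tuples I n. pr c xs * (sm v xs)\<^sup>2)"
    by (simp add: sum_tuples_Suc sum_distrib_right sum_distrib_left[of 2] flip: sum.distrib)
       (simp add: sum_distrib_left algebra_simps sum.distrib power2_eq_square)
  also have "\<dots> = (\<Sum>i\<in>I. c i * (v i)\<^sup>2) * (\<Sum>i\<in>I. c i) ^ n
      + n * (\<Sum>i\<in>I. c i * (v i)\<^sup>2) * (\<Sum>i\<in>I. c i) ^ n"
    using assms by (simp add: sum_pr_tuples Suc.IH)
  finally show ?case by (simp add: algebra_simps)
qed simp

text \<open>Chebyshev's inequality. With total mass \<open>C\<close> and second central moment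
  \<open>V\<close>, the deviating tuples carry mass at most
  \<open>V * C ^ n / (n * C * \<delta>\<^sup>2)\<close>, which is at most half of
  \<open>C ^ n\<close> once \<open>n\<close> reaches
  \<open>2 * V / (C * \<delta>\<^sup>2)\<close>.\<close>

lemma weak_law_tuples:
  fixes c v :: "'a \<Rightarrow> real" and m \<delta> :: real
  assumes fin: "finite I" and c: "\<And>i. i \<in> I \<Longrightarrow> 0 \<le> c i" and C: "0 < (\<Sum>i\<in>I. c i)"
    and mean: "(\<Sum>i\<in>I. c i * v i) = m * (\<Sum>i\<in>I. c i)" and \<delta>: "0 < \<delta>"
  shows "\<forall>\<^sub>F n in sequentially.
    (\<Sum>i\<in>I. c i) ^ n / 2 \<le> (\<Sum>xs | xs \<in> tuples I n \<and> \<bar>sm v xs - n * m\<bar> \<le> n * \<delta>. pr c xs)"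
proof -
  have nn: "0 \<le> pr c xs" if "xs \<in> tuples I n" for xs n
    using that c by (rule pr_nonneg[rotated])
  define w where "w i = v i - m" for i
  define C where "C = (\<Sum>i\<in>I. c i)"
  define V where "V = (\<Sum>i\<in>I. c i * (w i)\<^sup>2)"
  have C0: "0 < C" using C by (simp add: C_def)
  have w0: "(\<Sum>i\<in>I. c i * w i) = 0"
    using mean by (simp add: w_def right_diff_distrib sum_subtractf mult.commute flip: sum_distrib_left)
  have smw: "sm w xs = sm v xs - n * m" if "xs \<in> tuples I n" for xs n
  proof -
    have "sm w xs = sm v xs - length xs * m" by (induction xs) (simp_all add: w_def algebra_simps)
    then show ?thesis using that by (simp add: tuples_def)
  qed
  have "\<forall>\<^sub>F n in sequentially. 2 * V / (C * \<delta>\<^sup>2) \<le> real n"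
    using filterlim_real_sequentially by (simp add: filterlim_at_top)
  moreover have "\<forall>\<^sub>F n in sequentially. 1 \<le> n" by (rule eventually_ge_at_top)
  ultimately show ?thesis
  proof eventually_elim
    case (elim n)
    let ?G = "{xs. xs \<in> tuples I n \<and> \<bar>sm v xs - n * m\<bar> \<le> n * \<delta>}"
    let ?B = "tuples I n - ?G"
    have "(n * \<delta>)\<^sup>2 * (\<Sum>xs\<in>?B. pr c xs) \<le> (\<Sum>xs\<in>?B. pr c xs * (sm w xs)\<^sup>2)"
      unfolding sum_distrib_left
    proof (rule sum_mono)
      fix xs assume xs: "xs \<in> ?B"
      then have "n * \<delta> \<le> \<bar>sm w xs\<bar>" by (auto simp: smw)
      then have "(n * \<delta>)\<^sup>2 \<le> (sm w xs)\<^sup>2" using \<delta> by (intro abs_le_square_iff[THEN iffD1]) simp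
      then show "(n * \<delta>)\<^sup>2 * pr c xs \<le> pr c xs * (sm w xs)\<^sup>2"
        using nn[of xs n] xs by (simp add: mult.commute mult_left_mono)
    qed
    also have "\<dots> \<le> (\<Sum>xs\<in>tuples I n. pr c xs * (sm w xs)\<^sup>2)"
      using nn fin by (intro sum_mono2) auto
    finally have "C * ((n * \<delta>)\<^sup>2 * (\<Sum>xs\<in>?B. pr c xs)) \<le> C * (\<Sum>xs\<in>tuples I n. pr c xs * (sm w xs)\<^sup>2)"
      using C0 by simp
    also have "\<dots> = n * V * C ^ n" unfolding C_def V_def by (rule sum_pr_sm_square_tuples[OF w0])
    finally have "n * (n * (C * \<delta>\<^sup>2) * (\<Sum>xs\<in>?B. pr c xs)) \<le> n * (V * C ^ n)"
      by (simp add: power2_eq_square algebra_simps)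
    then have 1: "n * (C * \<delta>\<^sup>2) * (\<Sum>xs\<in>?B. pr c xs) \<le> V * C ^ n"
      using elim(2) by simp
    have "2 * V \<le> n * (C * \<delta>\<^sup>2)" using elim(1) C0 \<delta> by (simp add: field_simps)
    then have "2 * V * C ^ n \<le> n * (C * \<delta>\<^sup>2) * C ^ n" using C0 by (intro mult_right_mono) auto
    with 1 have "n * (C * \<delta>\<^sup>2) * (\<Sum>xs\<in>?B. pr c xs) \<le> n * (C * \<delta>\<^sup>2) * (C ^ n / 2)" by simp
    moreover have "0 < n * (C * \<delta>\<^sup>2)" using elim(2) C0 \<delta> by simp
    ultimately have "(\<Sum>xs\<in>?B. pr c xs) \<le> C ^ n / 2" by (simp only: mult_le_cancel_left_pos)
    moreover have "(\<Sum>xs\<in>tuples I n. pr c xs) = (\<Sum>xs\<in>?B. pr c xs) + (\<Sum>xs\<in>?G. pr c xs)"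
      using fin by (intro sum.subset_diff) auto
    ultimately show ?case unfolding C_def by (simp add: sum_pr_tuples)
  qed
qed

text \<open>For unit weights and \<open>u = ln v\<close> this is the power sum of \<open>v\<close>
  at \<open>s\<close>. The quotient \<open>mgf' / mgf\<close> is the mean of \<open>u\<close> under
  the weights tilted by \<open>exp (s * u i)\<close>. General weights \<open>b\<close> also allow
  the dual measure with weights \<open>exp (u i)\<close>.\<close>

definition mgf :: "'a set \<Rightarrow> ('a \<Rightarrow> real) \<Rightarrow> ('a \<Rightarrow> real) \<Rightarrow> real \<Rightarrow> real" where
  "mgf I b u s = (\<Sum>i\<in>I. b i * exp (s * u i))"

definition mgf' :: "'a set \<Rightarrow> ('a \<Rightarrow> real) \<Rightarrow> ('a \<Rightarrow> real) \<Rightarrow> real \<Rightarrow> real" where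
  "mgf' I b u s = (\<Sum>i\<in>I. b i * u i * exp (s * u i))"

lemma mgf_deriv: "(mgf I b u has_real_derivative mgf' I b u s) (at s)"
  unfolding mgf_def mgf'_def by (auto intro!: derivative_eq_intros sum.cong)

lemma isCont_mgf: "isCont (mgf I b u) s"
  using mgf_deriv by (rule DERIV_isCont)

lemma isCont_mgf': "isCont (mgf' I b u) s"
  unfolding mgf'_def by (intro continuous_intros)

lemma mgf_pos:
  assumes "finite I" "I \<noteq> {}" "\<And>i. i \<in> I \<Longrightarrow> 0 < b i"
  shows "0 < mgf I b u s"
  unfolding mgf_def using assms by (intro sum_pos) auto

text \<open>The threshold is \<open>exp (n * \<tau>)\<close>, so that \<tau> stays on the scale of a
  single letter while the sums grow exponentially in \<open>n\<close>.\<close>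

definition hinge :: "'a set \<Rightarrow> ('a \<Rightarrow> real) \<Rightarrow> ('a \<Rightarrow> real) \<Rightarrow> nat \<Rightarrow> real \<Rightarrow> real" where
  "hinge I b u n \<tau> = (\<Sum>xs\<in>tuples I n. pr b xs * max 0 (exp (sm u xs) - exp (n * \<tau>)))"

definition trunc :: "'a set \<Rightarrow> ('a \<Rightarrow> real) \<Rightarrow> ('a \<Rightarrow> real) \<Rightarrow> nat \<Rightarrow> real \<Rightarrow> real" where
  "trunc I b u n \<tau> = (\<Sum>xs\<in>tuples I n. pr b xs * min (exp (sm u xs)) (exp (n * \<tau>)))"

lemma sum_pr_exp_tuples: "(\<Sum>xs\<in>tuples I n. pr b xs * exp (s * sm u xs)) = mgf I b u s ^ n"
  by (simp add: mgf_def sum_pr_tuples flip: pr_exp_tilt)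

text \<open>Chernoff's bound: for positive x, y and s \<ge> 1, the positive part of x - y is at most
  x^s y^(1-s), and the sum of x^s over tuples factorizes.\<close>

lemma hinge_le:
  assumes b: "\<And>i. i \<in> I \<Longrightarrow> 0 < b i" and s: "1 \<le> s"
  shows "hinge I b u n \<tau> \<le> (mgf I b u s * exp ((1 - s) * \<tau>)) ^ n"
proof -
  have nn: "0 \<le> pr b xs" if "xs \<in> tuples I n" for xs n
    using that by (rule pr_nonneg[rotated]) (simp add: b less_imp_le)
  have "hinge I b u n \<tau> \<le> (\<Sum>xs\<in>tuples I n. pr b xs * (exp (s * sm u xs) * exp ((1 - s) * (n * \<tau>))))"
    unfolding hinge_def
  proof (rule sum_mono)
    fix xs assume xs: "xs \<in> tuples I n"
    let ?v = "sm u xs"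
    have "max 0 (exp ?v - exp (n * \<tau>)) \<le> exp (s * ?v) * exp ((1 - s) * (n * \<tau>))"
    proof (cases "?v \<le> n * \<tau>")
      case False
      then have "(s - 1) * (n * \<tau>) \<le> (s - 1) * ?v" using s by (intro mult_left_mono) auto
      then have "exp ?v \<le> exp (s * ?v + (1 - s) * (n * \<tau>))" by (simp add: algebra_simps)
      then show ?thesis by (simp add: exp_add)
        (smt (verit) exp_gt_zero mult_nonneg_nonneg)
    qed simp
    then show "pr b xs * max 0 (exp ?v - exp (n * \<tau>))
        \<le> pr b xs * (exp (s * ?v) * exp ((1 - s) * (n * \<tau>)))"
      using nn[OF xs] by (rule mult_left_mono)
  qed
  also have "\<dots> = mgf I b u s ^ n * exp (n * ((1 - s) * \<tau>))"
    by (simp add: mult.assoc mult.left_commute[of "1 - s"] flip: sum_pr_exp_tuples sum_distrib_right)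
       (simp add: sum_distrib_right mult.assoc)
  finally show ?thesis by (simp add: power_mult_distrib exp_of_nat_mult)
qed

text \<open>The minimum of two positive numbers is at most their geometric mean with weights
  \<open>s\<close> and \<open>1 - s\<close>.\<close>

lemma trunc_le:
  assumes b: "\<And>i. i \<in> I \<Longrightarrow> 0 < b i" and s: "0 \<le> s" "s \<le> 1"
  shows "trunc I b u n \<tau> \<le> (mgf I b u s * exp ((1 - s) * \<tau>)) ^ n"
proof -
  have nn: "0 \<le> pr b xs" if "xs \<in> tuples I n" for xs n
    using that by (rule pr_nonneg[rotated]) (simp add: b less_imp_le)
  have "trunc I b u n \<tau> \<le> (\<Sum>xs\<in>tuples I n. pr b xs * (exp (s * sm u xs) * exp ((1 - s) * (n * \<tau>))))"
    unfolding trunc_def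
  proof (rule sum_mono)
    fix xs assume xs: "xs \<in> tuples I n"
    let ?v = "sm u xs"
    have "min ?v (n * \<tau>) \<le> s * ?v + (1 - s) * (n * \<tau>)"
    proof -
      have "s * min ?v (n * \<tau>) + (1 - s) * min ?v (n * \<tau>) \<le> s * ?v + (1 - s) * (n * \<tau>)"
        using s by (intro add_mono mult_left_mono) auto
      then show ?thesis by (simp add: algebra_simps)
    qed
    then have "exp (min ?v (n * \<tau>)) \<le> exp (s * ?v) * exp ((1 - s) * (n * \<tau>))"
      by (simp flip: exp_add)
    then have "min (exp ?v) (exp (n * \<tau>)) \<le> exp (s * ?v) * exp ((1 - s) * (n * \<tau>))"
      by (auto simp: min_def split: if_splits)
    then show "pr b xs * min (exp ?v) (exp (n * \<tau>))
        \<le> pr b xs * (exp (s * ?v) * exp ((1 - s) * (n * \<tau>)))"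
      using nn[OF xs] by (rule mult_left_mono)
  qed
  also have "\<dots> = mgf I b u s ^ n * exp (n * ((1 - s) * \<tau>))"
    by (simp add: mult.assoc mult.left_commute[of "1 - s"] flip: sum_pr_exp_tuples sum_distrib_right)
       (simp add: sum_distrib_right mult.assoc)
  finally show ?thesis by (simp add: power_mult_distrib exp_of_nat_mult)
qed

lemma eventually_const_mult_power_le:
  fixes K L c :: real
  assumes "0 < K" "K < L" "0 < c"
  shows "\<forall>\<^sub>F n in sequentially. K ^ n \<le> c * L ^ n"
proof -
  have "(\<lambda>n. (K / L) ^ n) \<longlonglongrightarrow> 0"
    using assms by (intro LIMSEQ_realpow_zero) auto
  then have "\<forall>\<^sub>F n in sequentially. (K / L) ^ n < c"
    using assms(3) by (rule order_tendstoD)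
  then show ?thesis
    by eventually_elim (use assms in \<open>simp add: power_divide field_simps\<close>)
qed

text \<open>Cramer's bound: under the weights tilted by \<open>s\<close>, half of the mass lies on
  tuples with \<open>sm u xs\<close> close to \<open>n * \<mu>\<close>. As \<mu> is positive, these
  lie far above a threshold near 1, and undoing the tilt there costs about
  \<open>exp ((1 - s) * n * \<mu>)\<close>.\<close>

lemma hinge_ge:
  assumes fin: "finite I" and b: "\<And>i. i \<in> I \<Longrightarrow> 0 < b i" and s: "1 \<le> s"
    and M: "0 < mgf I b u s" and mean: "mgf' I b u s = \<mu> * mgf I b u s" and \<mu>: "0 < \<mu>"
    and K: "0 < K" "K < mgf I b u s * exp ((1 - s) * \<mu>)"
  shows "\<exists>\<epsilon>>0. \<forall>\<^sub>F n in sequentially. \<forall>\<tau>\<le>\<epsilon>. K ^ n \<le> hinge I b u n \<tau>"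
proof -
  have nn: "0 \<le> pr b xs" if "xs \<in> tuples I n" for xs n
    using that by (rule pr_nonneg[rotated]) (simp add: b less_imp_le)
  let ?L = "\<lambda>\<delta>. mgf I b u s * exp ((1 - s) * (\<mu> + \<delta>))"
  have "(?L \<longlongrightarrow> ?L 0) (at_right 0)" by (intro tendsto_intros)
  then have "\<forall>\<^sub>F \<delta> in at_right 0. K < ?L \<delta>" using K(2) by (intro order_tendstoD) auto
  \<comment> \<open>A third of \<mu> leaves room for three errors of size \<delta>: the deviation of
    the tuple, the size of \<tau>, and the margin that makes the threshold at most half of
    \<open>exp (sm u xs)\<close>.\<close>
  moreover have "\<forall>\<^sub>F \<delta> in at_right 0. \<delta> < \<mu> / 3 \<and> 0 < \<delta>"
    using \<mu> by (intro eventually_at_rightI[of 0 "\<mu> / 3"]) auto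
  ultimately have "\<forall>\<^sub>F \<delta> in at_right 0. K < ?L \<delta> \<and> \<delta> < \<mu> / 3 \<and> 0 < \<delta>"
    by (rule eventually_conj)
  then obtain \<delta> where \<delta>: "K < ?L \<delta>" "\<delta> < \<mu> / 3" "0 < \<delta>"
    using eventually_happens'[OF trivial_limit_at_right_real] by blast
  let ?c = "\<lambda>i. b i * exp (s * u i)"
  have C: "(\<Sum>i\<in>I. ?c i) = mgf I b u s" by (simp add: mgf_def)
  have "\<forall>\<^sub>F n in sequentially. (\<Sum>i\<in>I. ?c i) ^ n / 2
      \<le> (\<Sum>xs | xs \<in> tuples I n \<and> \<bar>sm u xs - n * \<mu>\<bar> \<le> n * \<delta>. pr ?c xs)"
  proof (rule weak_law_tuples[OF fin])
    show "(\<Sum>i\<in>I. ?c i * u i) = \<mu> * (\<Sum>i\<in>I. ?c i)"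
      using mean by (simp add: mgf_def mgf'_def mult_ac)
  qed (use b \<delta> M in \<open>auto simp: mgf_def less_imp_le\<close>)
  moreover have "\<forall>\<^sub>F n in sequentially. K ^ n \<le> (1 / 4) * ?L \<delta> ^ n"
    using \<delta> K by (intro eventually_const_mult_power_le) auto
  moreover have "\<forall>\<^sub>F n in sequentially. ln 2 / \<delta> \<le> real n"
    using filterlim_real_sequentially by (simp add: filterlim_at_top)
  ultimately have "\<forall>\<^sub>F n in sequentially. \<forall>\<tau>\<le>\<delta>. K ^ n \<le> hinge I b u n \<tau>"
  proof eventually_elim
    case (elim n)
    show ?case
    proof (intro allI impI)
      fix \<tau> :: real assume \<tau>: "\<tau> \<le> \<delta>"
      let ?G = "{xs. xs \<in> tuples I n \<and> \<bar>sm u xs - n * \<mu>\<bar> \<le> n * \<delta>}"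
      let ?e = "exp ((1 - s) * (n * (\<mu> + \<delta>)))"
      \<comment> \<open>One factor 1/2 is the typical share of the mass, the other is lost by
        subtracting the threshold.\<close>
      have "K ^ n \<le> (1 / 4) * ?L \<delta> ^ n" by (rule elim(2))
      also have "\<dots> = ?e / 2 * (mgf I b u s ^ n / 2)"
        by (simp add: power_mult_distrib flip: exp_of_nat_mult)
      also have "\<dots> \<le> ?e / 2 * (\<Sum>xs\<in>?G. pr ?c xs)"
        using elim(1) unfolding C by (intro mult_left_mono) auto
      also have "\<dots> \<le> (\<Sum>xs\<in>?G. pr b xs * max 0 (exp (sm u xs) - exp (n * \<tau>)))"
        unfolding sum_distrib_left
      proof (rule sum_mono)
        fix xs assume xs: "xs \<in> ?G"
        let ?v = "sm u xs"
        have v: "n * (\<mu> - \<delta>) \<le> ?v" "?v \<le> n * (\<mu> + \<delta>)" using xs by (auto simp: algebra_simps abs_le_iff)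
        have "ln 2 \<le> n * \<delta>" using elim(3) \<delta> by (simp add: field_simps)
        moreover have "n * \<delta> + n * \<tau> \<le> n * (\<mu> - \<delta>)"
        proof -
          have "\<delta> + \<tau> \<le> \<mu> - \<delta>" using \<delta> \<tau> by simp
          then show ?thesis by (metis distrib_left mult_left_mono of_nat_0_le_iff)
        qed
        ultimately have "exp (ln 2 + n * \<tau>) \<le> exp ?v" using v by simp
        then have 1: "exp ?v / 2 \<le> exp ?v - exp (n * \<tau>)" by (simp add: exp_add)
        have "(s - 1) * ?v \<le> (s - 1) * (n * (\<mu> + \<delta>))" using v s by (intro mult_left_mono) auto
        then have "exp ((1 - s) * (n * (\<mu> + \<delta>)) + s * ?v) \<le> exp ?v" by (simp add: algebra_simps)
        then have "?e * exp (s * ?v) / 2 \<le> exp ?v / 2" by (simp add: exp_add)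
        also have "\<dots> \<le> max 0 (exp ?v - exp (n * \<tau>))" using 1 by linarith
        finally have "pr b xs * (?e * exp (s * ?v) / 2) \<le> pr b xs * max 0 (exp ?v - exp (n * \<tau>))"
          using nn[of xs n] xs by (intro mult_left_mono) auto
        then show "?e / 2 * pr ?c xs \<le> pr b xs * max 0 (exp ?v - exp (n * \<tau>))"
          unfolding pr_exp_tilt by (simp add: mult_ac)
    qed
    also have "\<dots> \<le> hinge I b u n \<tau>"
      unfolding hinge_def using fin nn by (intro sum_mono2) auto
    finally show "K ^ n \<le> hinge I b u n \<tau>" .
    qed
  qed
  then show ?thesis using \<delta>(3) by blast
qed

text \<open>Cramer's bound for the minimum at a threshold near 1. \<open>crit\<close> says that
  \<open>s\<close> minimizes the convex function \<open>mgf\<close> on [0, 1]: either the tilted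
  mean is 0, or the minimum sits at 1, where typical tuples stay essentially below the threshold, or
  at 0, where they stay essentially above it.\<close>

lemma trunc_ge:
  assumes fin: "finite I" and b: "\<And>i. i \<in> I \<Longrightarrow> 0 < b i" and s: "0 \<le> s" "s \<le> 1"
    and M: "0 < mgf I b u s" and mean: "mgf' I b u s = \<mu> * mgf I b u s"
    and crit: "\<mu> = 0 \<or> s = 1 \<and> \<mu> \<le> 0 \<or> s = 0 \<and> 0 \<le> \<mu>"
    and K: "0 < K" "K < mgf I b u s"
  shows "\<exists>\<epsilon>>0. \<forall>\<^sub>F n in sequentially. \<forall>\<tau>\<ge>-\<epsilon>. K ^ n \<le> trunc I b u n \<tau>"
proof -
  have nn: "0 \<le> pr b xs" if "xs \<in> tuples I n" for xs n
    using that by (rule pr_nonneg[rotated]) (simp add: b less_imp_le)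
  let ?L = "\<lambda>\<delta>. mgf I b u s * exp (- 2 * \<delta>)"
  have "(?L \<longlongrightarrow> ?L 0) (at_right 0)" by (intro tendsto_intros)
  then have "\<forall>\<^sub>F \<delta> in at_right 0. K < ?L \<delta>" using K(2) by (intro order_tendstoD) auto
  moreover have "\<forall>\<^sub>F \<delta>::real in at_right 0. 0 < \<delta>"
    by (rule eventually_at_right_less)
  ultimately have "\<forall>\<^sub>F \<delta> in at_right 0. K < ?L \<delta> \<and> 0 < \<delta>"
    by (rule eventually_conj)
  then obtain \<delta> where \<delta>: "K < ?L \<delta>" "0 < \<delta>"
    using eventually_happens'[OF trivial_limit_at_right_real] by blast
  let ?c = "\<lambda>i. b i * exp (s * u i)"
  have C: "(\<Sum>i\<in>I. ?c i) = mgf I b u s" by (simp add: mgf_def)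
  have "\<forall>\<^sub>F n in sequentially. (\<Sum>i\<in>I. ?c i) ^ n / 2
      \<le> (\<Sum>xs | xs \<in> tuples I n \<and> \<bar>sm u xs - n * \<mu>\<bar> \<le> n * \<delta>. pr ?c xs)"
  proof (rule weak_law_tuples[OF fin])
    show "(\<Sum>i\<in>I. ?c i * u i) = \<mu> * (\<Sum>i\<in>I. ?c i)"
      using mean by (simp add: mgf_def mgf'_def mult_ac)
  qed (use b \<delta> M in \<open>auto simp: mgf_def less_imp_le\<close>)
  moreover have "\<forall>\<^sub>F n in sequentially. K ^ n \<le> (1 / 2) * ?L \<delta> ^ n"
    using \<delta> K by (intro eventually_const_mult_power_le) auto
  ultimately have "\<forall>\<^sub>F n in sequentially. \<forall>\<tau>\<ge>-\<delta>. K ^ n \<le> trunc I b u n \<tau>"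
  proof eventually_elim
    case (elim n)
    show ?case
    proof (intro allI impI)
      fix \<tau> :: real assume \<tau>: "-\<delta> \<le> \<tau>"
      let ?G = "{xs. xs \<in> tuples I n \<and> \<bar>sm u xs - n * \<mu>\<bar> \<le> n * \<delta>}"
      let ?e = "exp (- 2 * (n * \<delta>))"
      have "K ^ n \<le> (1 / 2) * ?L \<delta> ^ n" by (rule elim(2))
      also have "\<dots> = ?e * (mgf I b u s ^ n / 2)"
        by (simp add: power_mult_distrib flip: exp_of_nat_mult)
      also have "\<dots> \<le> ?e * (\<Sum>xs\<in>?G. pr ?c xs)"
        using elim(1) unfolding C by (intro mult_left_mono) auto
      also have "\<dots> \<le> (\<Sum>xs\<in>?G. pr b xs * min (exp (sm u xs)) (exp (n * \<tau>)))"
        unfolding sum_distrib_left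
      proof (rule sum_mono)
        fix xs assume xs: "xs \<in> ?G"
        let ?v = "sm u xs"
        have v: "n * \<mu> - n * \<delta> \<le> ?v" "?v \<le> n * \<mu> + n * \<delta>" using xs by (auto simp: abs_le_iff)
        have "n * (- \<delta>) \<le> n * \<tau>" using \<tau> by (intro mult_left_mono) auto
        \<comment> \<open>Both arguments of the minimum are thus at least
          \<open>exp (s * ?v)\<close> up to \<open>exp (- 2 * (n * \<delta>))\<close>: the first
          bound compares with \<open>exp ?v\<close>, the second with the threshold, where \<tau>
          \<ge> -\<delta> costs the other \<open>n * \<delta>\<close>.\<close>
        moreover have "s * ?v - n * \<delta> \<le> ?v \<and> s * ?v \<le> n * \<delta>"
          using crit
        proof (elim disjE conjE)
          assume "\<mu> = 0"
          then have 1: "\<bar>?v\<bar> \<le> n * \<delta>" using v by simp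
          then have 2: "\<bar>s * ?v\<bar> \<le> n * \<delta>" using s by (simp add: abs_mult) (smt (verit) mult_left_le_one_le abs_ge_zero)
          have "\<bar>(1 - s) * ?v\<bar> \<le> n * \<delta>"
            using 1 s by (simp add: abs_mult) (smt (verit) mult_left_le_one_le abs_ge_zero)
          with 2 show ?thesis by (auto simp: left_diff_distrib)
        next
          assume "s = 1" "\<mu> \<le> 0"
          then show ?thesis using v \<delta> mult_nonneg_nonpos[of "real n" \<mu>] by auto
        next
          assume "s = 0" "0 \<le> \<mu>"
          have "0 \<le> n * \<mu>" "0 \<le> n * \<delta>" using \<open>0 \<le> \<mu>\<close> \<delta> by simp_all
          then show ?thesis unfolding \<open>s = 0\<close> using v by (intro conjI; linarith)
        qed
        moreover have "0 \<le> n * \<delta>" using \<delta> by simp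
        ultimately have "- 2 * (n * \<delta>) + s * ?v \<le> ?v" "- 2 * (n * \<delta>) + s * ?v \<le> n * \<tau>" by auto
        then have "?e * exp (s * ?v) \<le> min (exp ?v) (exp (n * \<tau>))"
          by (simp flip: exp_add)
        then have "pr b xs * (?e * exp (s * ?v)) \<le> pr b xs * min (exp ?v) (exp (n * \<tau>))"
          using nn[of xs n] xs by (intro mult_left_mono) auto
        then show "?e * pr ?c xs \<le> pr b xs * min (exp ?v) (exp (n * \<tau>))"
          unfolding pr_exp_tilt by (simp add: mult_ac)
    qed
    also have "\<dots> \<le> trunc I b u n \<tau>"
      unfolding trunc_def using fin nn by (intro sum_mono2) auto
    finally show "K ^ n \<le> trunc I b u n \<tau>" .
    qed
  qed
  then show ?thesis using \<delta>(2) by blast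
qed

section \<open>Comparison of exponents\<close>

text \<open>Strict convexity of \<open>mgf\<close>, term by term: x exp(s x) increases strictly with
  s for each x \<noteq> 0.\<close>

lemma mgf'_strict_mono:
  assumes fin: "finite I" and b: "\<And>i. i \<in> I \<Longrightarrow> 0 < b i" and u: "i \<in> I" "u i \<noteq> 0" and "s < t"
  shows "mgf' I b u s < mgf' I b u t"
  unfolding mgf'_def
proof (rule sum_strict_mono_ex1[OF fin])
  have *: "x * exp (s * x) < x * exp (t * x)" if "x \<noteq> 0" for x :: real
    using that \<open>s < t\<close> by (cases "0 < x") auto
  show "\<forall>i\<in>I. b i * u i * exp (s * u i) \<le> b i * u i * exp (t * u i)"
  proof
    fix i assume "i \<in> I"
    then show "b i * u i * exp (s * u i) \<le> b i * u i * exp (t * u i)"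
      using *[of "u i"] b[of i] by (cases "u i = 0") (auto simp: mult.assoc)
  qed
  show "\<exists>i\<in>I. b i * u i * exp (s * u i) < b i * u i * exp (t * u i)"
    using *[of "u i"] u b[of i] by (auto simp: mult.assoc intro!: bexI[of _ i])
qed

text \<open>For large \<open>s\<close> a term with positive \<open>u i\<close> dominates, while the
  negative terms stay bounded because \<open>exp (s * u j) \<le> 1\<close> there.\<close>

lemma ex_mgf'_pos:
  assumes fin: "finite I" and b: "\<And>i. i \<in> I \<Longrightarrow> 0 < b i" and u: "i \<in> I" "0 < u i"
  shows "\<exists>s>1. 0 < mgf' I b u s"
proof -
  define B where "B = (\<Sum>j\<in>I - {i}. b j * \<bar>u j\<bar>)"
  have B: "0 \<le> B" unfolding B_def using b by (intro sum_nonneg) (auto simp: less_imp_le)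
  define D where "D = b i * u i * u i"
  \<comment> \<open>With this \<open>s\<close>, the estimate exp(x) \<ge> 1 + x already pushes the
    term of \<open>i\<close> above \<open>B\<close>, since \<open>D * s = 2 * D + B\<close>.\<close>
  define s where "s = 2 + B / D"
  have bi: "0 < b i * u i" using u b by simp
  then have D: "0 < D" using u by (simp add: D_def)
  then have s: "1 < s" using B by (simp add: s_def add_pos_nonneg)
  have "B < D * s"
    using D by (simp add: s_def distrib_left)
  also have "\<dots> = b i * u i * (s * u i)" by (simp add: D_def)
  also have "\<dots> \<le> b i * u i * exp (s * u i)"
    using bi exp_ge_add_one_self[of "s * u i"] by (intro mult_left_mono) linarith+
  finally have "B < b i * u i * exp (s * u i)" .
  moreover have "- B \<le> (\<Sum>j\<in>I - {i}. b j * u j * exp (s * u j))"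
    unfolding B_def sum_negf[symmetric]
  proof (rule sum_mono)
    fix j assume j: "j \<in> I - {i}"
    have "- \<bar>u j\<bar> \<le> u j * exp (s * u j)"
    proof (cases "0 \<le> u j")
      case False
      then have "exp (s * u j) \<le> 1" using s by (simp add: mult_nonneg_nonpos)
      with False have "u j * 1 \<le> u j * exp (s * u j)" by (intro mult_left_mono_neg) auto
      with False show ?thesis by simp
    qed (simp add: order_trans[of _ 0])
    then have "b j * (- \<bar>u j\<bar>) \<le> b j * (u j * exp (s * u j))"
      using b[of j] j by (intro mult_left_mono) auto
    then show "- (b j * \<bar>u j\<bar>) \<le> b j * u j * exp (s * u j)" by (simp add: mult.assoc)
  qed
  moreover have "mgf' I b u s = b i * u i * exp (s * u i) + (\<Sum>j\<in>I - {i}. b j * u j * exp (s * u j))"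
    unfolding mgf'_def using fin u by (intro sum.remove)
  ultimately show ?thesis using s by (intro exI[of _ s]) simp
qed

text \<open>The growth rate of \<open>hinge I\<close> at threshold 1 is the minimum of its
  \<open>mgf\<close> over [1, \<infinity>), attained at \<open>s0\<close>. Some Chernoff exponent
  \<open>t\<close> for \<open>J\<close> stays strictly below that minimum, so a \<open>K\<close> in
  between separates the two sums.\<close>

lemma hinge_le_hinge_near_0:
  assumes fin: "finite I" "finite J"
    and b: "\<And>i. i \<in> I \<Longrightarrow> 0 < b i" and c: "\<And>j. j \<in> J \<Longrightarrow> 0 < c j"
    and u: "\<exists>i\<in>I. 0 < u i"
    and eq: "mgf J c w 1 = mgf I b u 1"
    and less: "\<And>s. 1 < s \<Longrightarrow> mgf J c w s < mgf I b u s"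
    and neg: "mgf' J c w 1 < 0"
  shows "\<exists>\<epsilon>>0. \<forall>\<^sub>F n in sequentially. \<forall>\<tau>. \<bar>\<tau>\<bar> < \<epsilon> \<longrightarrow> hinge J c w n \<tau> \<le> hinge I b u n \<tau>"
proof -
  obtain i where i: "i \<in> I" "0 < u i" using u by blast
  have Ipos: "0 < mgf I b u s" for s using fin b i by (intro mgf_pos) auto
  have "J \<noteq> {}" using Ipos[of 1] eq by (auto simp: mgf_def)
  then have Jpos: "0 < mgf J c w s" for s using fin c by (intro mgf_pos) auto
  \<comment> \<open>By convexity this is the minimizer: \<open>s0 = 1\<close> if the slope there is
    non-negative, otherwise a zero of the slope. In both cases the correction
    \<open>(1 - s0) * \<mu> s0\<close> vanishes.\<close>
  obtain s0 where s0: "1 \<le> s0" "0 \<le> mgf' I b u s0" "s0 = 1 \<or> mgf' I b u s0 = 0"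
  proof (cases "0 \<le> mgf' I b u 1")
    case False
    have "\<exists>s>1. 0 < mgf' I b u s" by (rule ex_mgf'_pos[where i = i]) (use fin b i in auto)
    then obtain S where S: "1 < S" "0 < mgf' I b u S" by blast
    have "\<exists>s\<ge>1. s \<le> S \<and> mgf' I b u s = 0"
      by (rule IVT) (use S False isCont_mgf' in auto)
    then obtain s where "1 \<le> s" "mgf' I b u s = 0" by blast
    then show ?thesis using that by simp
  qed (use that in auto)
  \<comment> \<open>At 1 the two functions agree, so the strict gap comes from the negative slope of
    the one for \<open>J\<close> just to the right. Beyond 1 the hypothesis gives it at
    \<open>s0\<close> itself.\<close>
  have "\<exists>s\<ge>1. mgf J c w s < mgf I b u s0"
  proof (cases "s0 = 1")
    case True
    obtain d where "0 < d" "\<And>h. 0 < h \<Longrightarrow> h < d \<Longrightarrow> mgf J c w (1 + h) < mgf J c w 1"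
      using DERIV_neg_dec_right[OF mgf_deriv neg] by blast
    from this(1) this(2)[of "d / 2"] show ?thesis
      unfolding True eq by (intro exI[of _ "1 + d / 2"]) auto
  next
    case False
    then show ?thesis using less[of s0] s0(1) by (intro exI[of _ s0]) auto
  qed
  then obtain t where t: "1 \<le> t" "mgf J c w t < mgf I b u s0" by blast
  define K where "K = (mgf J c w t + mgf I b u s0) / 2"
  have K: "mgf J c w t < K" "K < mgf I b u s0" "0 < K" using t Jpos[of t] Ipos[of s0] by (auto simp: K_def)
  define \<mu> where "\<mu> s = mgf' I b u s / mgf I b u s" for s
  \<comment> \<open>The tilted mean may be 0 at \<open>s0\<close>, whereas Cramer's bound asks for a
    positive mean. A slightly larger \<open>s\<close> has one by strict convexity, and continuity
    keeps the rate above \<open>K\<close>.\<close>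
  let ?L = "\<lambda>s. mgf I b u s * exp ((1 - s) * \<mu> s)"
  have "isCont ?L s0" unfolding \<mu>_def using Ipos[of s0]
    by (intro continuous_intros isCont_mgf isCont_mgf') auto
  then have "(?L \<longlongrightarrow> ?L s0) (at_right s0)"
    unfolding isCont_def by (rule filterlim_mono) (auto intro: at_le)
  moreover have "?L s0 = mgf I b u s0" using s0(3) by (auto simp: \<mu>_def)
  ultimately have "\<forall>\<^sub>F s in at_right s0. K < ?L s" using K(2) by (intro order_tendstoD) auto
  then have "\<forall>\<^sub>F s in at_right s0. K < ?L s \<and> s0 < s"
    by (rule eventually_conj[OF _ eventually_at_right_less])
  then obtain s where s: "K < ?L s" "s0 < s"
    using eventually_happens'[OF trivial_limit_at_right_real] by blast
  have "mgf' I b u s0 < mgf' I b u s"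
    by (rule mgf'_strict_mono[where i = i]) (use fin b i s in auto)
  then have "0 < mgf' I b u s" using s0(2) by simp
  then have \<mu>: "0 < \<mu> s" "mgf' I b u s = \<mu> s * mgf I b u s" using Ipos[of s] by (simp_all add: \<mu>_def)
  have "\<exists>\<epsilon>>0. \<forall>\<^sub>F n in sequentially. \<forall>\<tau>\<le>\<epsilon>. K ^ n \<le> hinge I b u n \<tau>"
    by (rule hinge_ge[where s = s and \<mu> = "\<mu> s"]) (use s s0 fin b Ipos \<mu> K in auto)
  then obtain \<epsilon> where \<epsilon>: "0 < \<epsilon>" "\<forall>\<^sub>F n in sequentially. \<forall>\<tau>\<le>\<epsilon>. K ^ n \<le> hinge I b u n \<tau>" by blast
  have "((\<lambda>\<tau>. mgf J c w t * exp ((1 - t) * \<tau>)) \<longlongrightarrow> mgf J c w t * exp ((1 - t) * 0)) (at_left 0)"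
    by (intro tendsto_intros)
  then have "\<forall>\<^sub>F \<tau> in at_left 0. mgf J c w t * exp ((1 - t) * \<tau>) < K"
    using K(1) by (intro order_tendstoD) auto
  then obtain \<tau>0 where \<tau>0: "\<tau>0 < 0" "\<forall>\<tau>>\<tau>0. \<tau> < 0 \<longrightarrow> mgf J c w t * exp ((1 - t) * \<tau>) < K"
    unfolding eventually_at_left_field by blast
  have \<tau>1: "\<tau>0 / 2 < 0" "mgf J c w t * exp ((1 - t) * (\<tau>0 / 2)) < K"
    using \<tau>0(1) \<tau>0(2)[rule_format, of "\<tau>0 / 2"] by simp_all
  \<comment> \<open>The Chernoff bound decreases in \<tau> as \<open>t \<ge> 1\<close>, so its value
    at one negative point covers everything to the right.\<close>
  have upper: "hinge J c w n \<tau> \<le> K ^ n" if "\<tau>0 / 2 \<le> \<tau>" for n \<tau>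
  proof -
    have "(1 - t) * \<tau> \<le> (1 - t) * (\<tau>0 / 2)" using that t(1) by (intro mult_left_mono_neg) auto
    then have "mgf J c w t * exp ((1 - t) * \<tau>) \<le> mgf J c w t * exp ((1 - t) * (\<tau>0 / 2))"
      using Jpos[of t] by simp
    then have "mgf J c w t * exp ((1 - t) * \<tau>) \<le> K" using \<tau>1(2) by simp
    moreover have "0 \<le> mgf J c w t * exp ((1 - t) * \<tau>)" using Jpos[of t] by simp
    ultimately have "(mgf J c w t * exp ((1 - t) * \<tau>)) ^ n \<le> K ^ n" by (intro power_mono)
    moreover have "hinge J c w n \<tau> \<le> (mgf J c w t * exp ((1 - t) * \<tau>)) ^ n"
      by (intro hinge_le c t)
    ultimately show ?thesis by simp
  qed
  have "\<forall>\<^sub>F n in sequentially. \<forall>\<tau>. \<bar>\<tau>\<bar> < min \<epsilon> (- (\<tau>0 / 2)) \<longrightarrow> hinge J c w n \<tau> \<le> hinge I b u n \<tau>"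
    using \<epsilon>(2)
  proof eventually_elim
    case (elim n)
    show ?case
    proof (intro allI impI)
      fix \<tau> :: real assume \<tau>: "\<bar>\<tau>\<bar> < min \<epsilon> (- (\<tau>0 / 2))"
      from \<tau> have "hinge J c w n \<tau> \<le> K ^ n" by (intro upper) auto
      also have "\<dots> \<le> hinge I b u n \<tau>" using elim \<tau> by auto
      finally show "hinge J c w n \<tau> \<le> hinge I b u n \<tau>" .
    qed
  qed
  then show ?thesis using \<epsilon>(1) \<tau>1(1) by (intro exI[of _ "min \<epsilon> (- (\<tau>0 / 2))"]) auto
qed

text \<open>The roles are reversed: now \<open>J\<close> is bounded below, at the minimizer
  \<open>s\<close> of its \<open>mgf\<close> over [0, 1], and \<open>I\<close> above by Chernoff at
  some \<open>t\<close> in [0, 1] with a strictly smaller value.\<close>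

lemma trunc_le_trunc_near_0:
  assumes fin: "finite I" "finite J" and ne: "I \<noteq> {}" "J \<noteq> {}"
    and b: "\<And>i. i \<in> I \<Longrightarrow> 0 < b i" and c: "\<And>j. j \<in> J \<Longrightarrow> 0 < c j"
    and eq: "mgf I b u 1 = mgf J c w 1"
    and less: "\<And>s. 0 < s \<Longrightarrow> s < 1 \<Longrightarrow> mgf I b u s < mgf J c w s"
    and le: "mgf I b u 0 \<le> mgf J c w 0"
    and pos: "0 < mgf' I b u 1" and neg: "mgf' I b u 0 < 0 \<or> mgf I b u 0 < mgf J c w 0"
  shows "\<exists>\<epsilon>>0. \<forall>\<^sub>F n in sequentially. \<forall>\<tau>. \<bar>\<tau>\<bar> < \<epsilon> \<longrightarrow> trunc I b u n \<tau> \<le> trunc J c w n \<tau>"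
proof -
  have Ipos: "0 < mgf I b u s" for s using fin ne b by (intro mgf_pos) auto
  have Jpos: "0 < mgf J c w s" for s using fin ne c by (intro mgf_pos) auto
  define \<mu> where "\<mu> s = mgf' J c w s / mgf J c w s" for s
  \<comment> \<open>The tilted mean either has the sign that puts the minimum at an endpoint, or it
    changes sign and vanishes in between.\<close>
  have "\<exists>s. 0 \<le> s \<and> s \<le> 1 \<and> (\<mu> s = 0 \<or> s = 1 \<and> \<mu> s \<le> 0 \<or> s = 0 \<and> 0 \<le> \<mu> s)"
  proof (cases "\<mu> 1 \<le> 0 \<or> 0 \<le> \<mu> 0")
    case False
    have "isCont \<mu> s" for s unfolding \<mu>_def using Jpos[of s]
      by (intro continuous_intros isCont_mgf isCont_mgf') auto
    then have "\<exists>s\<ge>0. s \<le> 1 \<and> \<mu> s = 0"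
      by (intro IVT) (use False in auto)
    then show ?thesis by blast
  qed (use zero_le_one in blast)
  then obtain s where s: "0 \<le> s" "s \<le> 1" "\<mu> s = 0 \<or> s = 1 \<and> \<mu> s \<le> 0 \<or> s = 0 \<and> 0 \<le> \<mu> s" by blast
  \<comment> \<open>For interior \<open>s\<close> take \<open>t = s\<close>. At an endpoint where
    only a weak comparison holds, the slope of the function for \<open>I\<close> makes it strictly
    smaller a little further inside.\<close>
  have "\<exists>t. 0 \<le> t \<and> t \<le> 1 \<and> mgf I b u t < mgf J c w s"
  proof -
    consider "s = 0" | "0 < s" "s < 1" | "s = 1" using s by linarith
    then show ?thesis
    proof cases
      case 1
      show ?thesis
      proof (cases "mgf I b u 0 < mgf J c w 0")
        case False
        with neg obtain d where d: "0 < d" "\<And>h. 0 < h \<Longrightarrow> h < d \<Longrightarrow> mgf I b u (0 + h) < mgf I b u 0"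
          using DERIV_neg_dec_right[OF mgf_deriv[of I b u 0]] by blast
        from d(1) have "0 < min 1 (d / 2)" "min 1 (d / 2) < d" by linarith+
        then have "mgf I b u (0 + min 1 (d / 2)) < mgf I b u 0" by (rule d(2))
        then show ?thesis
          using le \<open>0 < d\<close> unfolding 1 by (intro exI[of _ "min 1 (d / 2)"]) auto
      qed (use 1 in auto)
    next
      case 3
      obtain d where d: "0 < d" "\<And>h. 0 < h \<Longrightarrow> h < d \<Longrightarrow> mgf I b u (1 - h) < mgf I b u 1"
        using DERIV_pos_inc_left[OF mgf_deriv pos] by blast
      from d(1) have "0 < min 1 (d / 2)" "min 1 (d / 2) < d" by linarith+
      then have "mgf I b u (1 - min 1 (d / 2)) < mgf I b u 1" by (rule d(2))
      then show ?thesis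
        using eq \<open>0 < d\<close> unfolding 3 by (intro exI[of _ "1 - min 1 (d / 2)"]) auto
    next
      case 2
      then show ?thesis using less[of s] by (intro exI[of _ s]) auto
    qed
  qed
  then obtain t where t: "0 \<le> t" "t \<le> 1" "mgf I b u t < mgf J c w s" by blast
  define K where "K = (mgf I b u t + mgf J c w s) / 2"
  have K: "mgf I b u t < K" "K < mgf J c w s" "0 < K" using t Ipos[of t] Jpos[of s] by (auto simp: K_def)
  have \<mu>: "mgf' J c w s = \<mu> s * mgf J c w s" using Jpos[of s] by (simp add: \<mu>_def)
  obtain \<epsilon> where \<epsilon>: "0 < \<epsilon>" "\<forall>\<^sub>F n in sequentially. \<forall>\<tau>\<ge>-\<epsilon>. K ^ n \<le> trunc J c w n \<tau>"
  proof -
    have "\<exists>\<epsilon>>0. \<forall>\<^sub>F n in sequentially. \<forall>\<tau>\<ge>-\<epsilon>. K ^ n \<le> trunc J c w n \<tau>"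
      by (rule trunc_ge[where s = s and \<mu> = "\<mu> s"]) (use s fin c Jpos \<mu> K in auto)
    then show ?thesis using that by blast
  qed
  have "((\<lambda>\<tau>. mgf I b u t * exp ((1 - t) * \<tau>)) \<longlongrightarrow> mgf I b u t * exp ((1 - t) * 0)) (at_right 0)"
    by (intro tendsto_intros)
  then have "\<forall>\<^sub>F \<tau> in at_right 0. mgf I b u t * exp ((1 - t) * \<tau>) < K"
    using K(1) by (intro order_tendstoD) auto
  then obtain \<tau>0 where \<tau>0: "0 < \<tau>0" "\<forall>\<tau>>0. \<tau> < \<tau>0 \<longrightarrow> mgf I b u t * exp ((1 - t) * \<tau>) < K"
    unfolding eventually_at_right_field by blast
  have \<tau>1: "0 < \<tau>0 / 2" "mgf I b u t * exp ((1 - t) * (\<tau>0 / 2)) < K"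
    using \<tau>0(1) \<tau>0(2)[rule_format, of "\<tau>0 / 2"] by simp_all
  have upper: "trunc I b u n \<tau> \<le> K ^ n" if "\<tau> \<le> \<tau>0 / 2" for n \<tau>
  proof -
    have "(1 - t) * \<tau> \<le> (1 - t) * (\<tau>0 / 2)" using that t(2) by (intro mult_left_mono) auto
    then have "mgf I b u t * exp ((1 - t) * \<tau>) \<le> mgf I b u t * exp ((1 - t) * (\<tau>0 / 2))"
      using Ipos[of t] by simp
    then have "mgf I b u t * exp ((1 - t) * \<tau>) \<le> K" using \<tau>1(2) by simp
    moreover have "0 \<le> mgf I b u t * exp ((1 - t) * \<tau>)" using Ipos[of t] by simp
    ultimately have "(mgf I b u t * exp ((1 - t) * \<tau>)) ^ n \<le> K ^ n" by (intro power_mono)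
    moreover have "trunc I b u n \<tau> \<le> (mgf I b u t * exp ((1 - t) * \<tau>)) ^ n"
      by (intro trunc_le b t)
    ultimately show ?thesis by simp
  qed
  have "\<forall>\<^sub>F n in sequentially. \<forall>\<tau>. \<bar>\<tau>\<bar> < min \<epsilon> (\<tau>0 / 2) \<longrightarrow> trunc I b u n \<tau> \<le> trunc J c w n \<tau>"
    using \<epsilon>(2)
  proof eventually_elim
    case (elim n)
    show ?case
    proof (intro allI impI)
      fix \<tau> :: real assume \<tau>: "\<bar>\<tau>\<bar> < min \<epsilon> (\<tau>0 / 2)"
      from \<tau> have "trunc I b u n \<tau> \<le> K ^ n" by (intro upper) auto
      also have "\<dots> \<le> trunc J c w n \<tau>" using elim \<tau> by auto
      finally show "trunc I b u n \<tau> \<le> trunc J c w n \<tau>" .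
    qed
  qed
  then show ?thesis using \<epsilon>(1) \<tau>1(1) by (intro exI[of _ "min \<epsilon> (\<tau>0 / 2)"]) auto
qed

section \<open>Translation of a general threshold to 0\<close>

lemma sm_shift: "xs \<in> tuples I n \<Longrightarrow> sm (\<lambda>i. u i - t) xs = sm u xs - n * t"
proof -
  have "sm (\<lambda>i. u i - t) xs = sm u xs - length xs * t" for xs
    by (induction xs) (simp_all add: algebra_simps)
  then show "xs \<in> tuples I n \<Longrightarrow> sm (\<lambda>i. u i - t) xs = sm u xs - n * t"
    by (simp add: tuples_def)
qed

lemma mgf_shift: "mgf I b (\<lambda>i. u i - t) s = exp (- s * t) * mgf I b u s"
  by (simp add: mgf_def sum_distrib_left exp_diff exp_minus right_diff_distrib divide_inverse mult_ac)

lemma mgf'_shift: "mgf' I b (\<lambda>i. u i - t) s = exp (- s * t) * (mgf' I b u s - t * mgf I b u s)"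
  by (simp add: mgf_def mgf'_def sum_distrib_left exp_diff exp_minus right_diff_distrib left_diff_distrib
      divide_inverse mult_ac sum_subtractf)

lemma hinge_shift: "hinge I b (\<lambda>i. u i - t) n (\<tau> - t) = exp (- (n * t)) * hinge I b u n \<tau>"
  unfolding hinge_def sum_distrib_left
proof (rule sum.cong[OF refl])
  fix xs assume xs: "xs \<in> tuples I n"
  have "max 0 (exp (sm u xs - n * t) - exp (n * (\<tau> - t)))
      = max 0 (exp (- (n * t)) * (exp (sm u xs) - exp (n * \<tau>)))"
    by (simp add: right_diff_distrib exp_diff exp_minus divide_inverse mult_ac)
  also have "\<dots> = exp (- (n * t)) * max 0 (exp (sm u xs) - exp (n * \<tau>))"
    by (simp add: max_mult_distrib_left)
  finally show "pr b xs * max 0 (exp (sm (\<lambda>i. u i - t) xs) - exp (n * (\<tau> - t)))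
      = exp (- (n * t)) * (pr b xs * max 0 (exp (sm u xs) - exp (n * \<tau>)))"
    unfolding sm_shift[OF xs] by simp
qed

lemma trunc_shift: "trunc I b (\<lambda>i. u i - t) n (\<tau> - t) = exp (- (n * t)) * trunc I b u n \<tau>"
  unfolding trunc_def sum_distrib_left
proof (rule sum.cong[OF refl])
  fix xs assume xs: "xs \<in> tuples I n"
  have "min (exp (sm u xs - n * t)) (exp (n * (\<tau> - t)))
      = min (exp (- (n * t)) * exp (sm u xs)) (exp (- (n * t)) * exp (n * \<tau>))"
    by (simp add: right_diff_distrib exp_diff exp_minus divide_inverse mult_ac)
  also have "\<dots> = exp (- (n * t)) * min (exp (sm u xs)) (exp (n * \<tau>))"
    by (simp add: min_mult_distrib_left)
  finally show "pr b xs * min (exp (sm (\<lambda>i. u i - t) xs)) (exp (n * (\<tau> - t)))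
      = exp (- (n * t)) * (pr b xs * min (exp (sm u xs)) (exp (n * \<tau>)))"
    unfolding sm_shift[OF xs] by simp
qed

lemma hinge_le_hinge_near:
  assumes fin: "finite I" "finite J"
    and b: "\<And>i. i \<in> I \<Longrightarrow> 0 < b i" and c: "\<And>j. j \<in> J \<Longrightarrow> 0 < c j"
    and u: "\<exists>i\<in>I. t < u i"
    and eq: "mgf J c w 1 = mgf I b u 1"
    and less: "\<And>s. 1 < s \<Longrightarrow> mgf J c w s < mgf I b u s"
    and mean: "mgf' J c w 1 < t * mgf J c w 1"
  shows "\<exists>\<epsilon>>0. \<forall>\<^sub>F n in sequentially. \<forall>\<tau>. \<bar>\<tau> - t\<bar> < \<epsilon> \<longrightarrow> hinge J c w n \<tau> \<le> hinge I b u n \<tau>"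
proof -
  have "\<exists>\<epsilon>>0. \<forall>\<^sub>F n in sequentially. \<forall>\<tau>. \<bar>\<tau>\<bar> < \<epsilon> \<longrightarrow>
      hinge J c (\<lambda>j. w j - t) n \<tau> \<le> hinge I b (\<lambda>i. u i - t) n \<tau>"
  proof (rule hinge_le_hinge_near_0[OF fin b c])
    show "\<exists>i\<in>I. 0 < u i - t" using u by auto
    show "mgf J c (\<lambda>j. w j - t) 1 = mgf I b (\<lambda>i. u i - t) 1" unfolding mgf_shift eq ..
    show "mgf J c (\<lambda>j. w j - t) s < mgf I b (\<lambda>i. u i - t) s" if "1 < s" for s
      unfolding mgf_shift using less[OF that] by simp
    show "mgf' J c (\<lambda>j. w j - t) 1 < 0" unfolding mgf'_shift using mean by (simp add: mult_pos_neg)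
  qed
  then obtain \<epsilon> where \<epsilon>: "0 < \<epsilon>" "\<forall>\<^sub>F n in sequentially. \<forall>\<tau>. \<bar>\<tau>\<bar> < \<epsilon> \<longrightarrow>
      hinge J c (\<lambda>j. w j - t) n \<tau> \<le> hinge I b (\<lambda>i. u i - t) n \<tau>" by blast
  from \<epsilon>(2) have "\<forall>\<^sub>F n in sequentially. \<forall>\<tau>. \<bar>\<tau> - t\<bar> < \<epsilon> \<longrightarrow> hinge J c w n \<tau> \<le> hinge I b u n \<tau>"
  proof eventually_elim
    case (elim n)
    show ?case
    proof (intro allI impI)
      fix \<tau> assume "\<bar>\<tau> - t\<bar> < \<epsilon>"
      with elim have "hinge J c (\<lambda>j. w j - t) n (\<tau> - t) \<le> hinge I b (\<lambda>i. u i - t) n (\<tau> - t)" by blast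
      then show "hinge J c w n \<tau> \<le> hinge I b u n \<tau>" unfolding hinge_shift by simp
    qed
  qed
  with \<epsilon>(1) show ?thesis by blast
qed

lemma trunc_le_trunc_near:
  assumes fin: "finite I" "finite J" and ne: "I \<noteq> {}" "J \<noteq> {}"
    and b: "\<And>i. i \<in> I \<Longrightarrow> 0 < b i" and c: "\<And>j. j \<in> J \<Longrightarrow> 0 < c j"
    and eq: "mgf I b u 1 = mgf J c w 1"
    and less: "\<And>s. 0 < s \<Longrightarrow> s < 1 \<Longrightarrow> mgf I b u s < mgf J c w s"
    and le: "mgf I b u 0 \<le> mgf J c w 0"
    and pos: "t * mgf I b u 1 < mgf' I b u 1"
    and neg: "mgf' I b u 0 < t * mgf I b u 0 \<or> mgf I b u 0 < mgf J c w 0"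
  shows "\<exists>\<epsilon>>0. \<forall>\<^sub>F n in sequentially. \<forall>\<tau>. \<bar>\<tau> - t\<bar> < \<epsilon> \<longrightarrow> trunc I b u n \<tau> \<le> trunc J c w n \<tau>"
proof -
  have "\<exists>\<epsilon>>0. \<forall>\<^sub>F n in sequentially. \<forall>\<tau>. \<bar>\<tau>\<bar> < \<epsilon> \<longrightarrow>
      trunc I b (\<lambda>i. u i - t) n \<tau> \<le> trunc J c (\<lambda>j. w j - t) n \<tau>"
  proof (rule trunc_le_trunc_near_0[OF fin ne b c])
    show "mgf I b (\<lambda>i. u i - t) 1 = mgf J c (\<lambda>j. w j - t) 1" unfolding mgf_shift eq ..
    show "mgf I b (\<lambda>i. u i - t) s < mgf J c (\<lambda>j. w j - t) s" if "0 < s" "s < 1" for s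
      unfolding mgf_shift using less[OF that] by simp
    show "mgf I b (\<lambda>i. u i - t) 0 \<le> mgf J c (\<lambda>j. w j - t) 0"
      unfolding mgf_shift using le by simp
    show "0 < mgf' I b (\<lambda>i. u i - t) 1" unfolding mgf'_shift using pos by simp
    show "mgf' I b (\<lambda>i. u i - t) 0 < 0 \<or> mgf I b (\<lambda>i. u i - t) 0 < mgf J c (\<lambda>j. w j - t) 0"
      unfolding mgf'_shift mgf_shift using neg by simp
  qed
  then obtain \<epsilon> where \<epsilon>: "0 < \<epsilon>" "\<forall>\<^sub>F n in sequentially. \<forall>\<tau>. \<bar>\<tau>\<bar> < \<epsilon> \<longrightarrow>
      trunc I b (\<lambda>i. u i - t) n \<tau> \<le> trunc J c (\<lambda>j. w j - t) n \<tau>" by blast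
  from \<epsilon>(2) have "\<forall>\<^sub>F n in sequentially. \<forall>\<tau>. \<bar>\<tau> - t\<bar> < \<epsilon> \<longrightarrow> trunc I b u n \<tau> \<le> trunc J c w n \<tau>"
  proof eventually_elim
    case (elim n)
    show ?case
    proof (intro allI impI)
      fix \<tau> assume "\<bar>\<tau> - t\<bar> < \<epsilon>"
      with elim have "trunc I b (\<lambda>i. u i - t) n (\<tau> - t) \<le> trunc J c (\<lambda>j. w j - t) n (\<tau> - t)" by blast
      then show "trunc I b u n \<tau> \<le> trunc J c w n \<tau>" unfolding trunc_shift by simp
    qed
  qed
  with \<epsilon>(1) show ?thesis by blast
qed

section \<open>Unit weights and the dual measure\<close>

lemma pr_1 [simp]: "pr (\<lambda>_. 1) xs = 1"
  by (induction xs) auto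

lemma pr_exp: "pr (\<lambda>i. exp (u i)) xs = exp (sm u xs)"
  by (induction xs) (auto simp: exp_add)

lemma sm_uminus: "sm (\<lambda>i. - u i) xs = - sm u xs" for u :: "'a \<Rightarrow> real"
  by (induction xs) auto

lemma sum_exp_tuples: "(\<Sum>xs\<in>tuples I n. exp (sm u xs)) = mgf I (\<lambda>_. 1) u 1 ^ n"
  using sum_pr_exp_tuples[of "\<lambda>_. 1" 1 u I n] by simp

lemma sum_const_tuples: "(\<Sum>xs\<in>tuples I n. c) = c * real (card I) ^ n"
proof -
  have "(\<Sum>xs\<in>tuples I n. c) = c * (\<Sum>xs\<in>tuples I n. pr (\<lambda>_. 1) xs)"
    unfolding sum_distrib_left by simp
  then show ?thesis unfolding sum_pr_tuples by simp
qed

text \<open>When the total masses agree, comparing hinges is therefore comparing truncations in the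
  opposite direction.\<close>

lemma hinge_eq_trunc: "hinge I (\<lambda>_. 1) u n \<tau> = mgf I (\<lambda>_. 1) u 1 ^ n - trunc I (\<lambda>_. 1) u n \<tau>"
proof -
  have "max 0 (x - y) = x - min x y" for x y :: real by (simp add: max_def min_def)
  then show ?thesis by (simp add: hinge_def trunc_def sum_subtractf sum_exp_tuples)
qed

text \<open>Exchanging the roles of the two measures in a pair: \<open>(y - t)\<^sup>+ = y - t + t y (1/y - 1/t)\<^sup>+\<close>.\<close>

lemma hinge_eq_dual:
  "hinge I (\<lambda>_. 1) u n \<tau> = mgf I (\<lambda>_. 1) u 1 ^ n - real (card I) ^ n * exp (n * \<tau>)
     + exp (n * \<tau>) * hinge I (\<lambda>i. exp (u i)) (\<lambda>i. - u i) n (- \<tau>)"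
proof -
  have *: "max 0 (x - y) = x - y + y * (x * max 0 (1 / x - 1 / y))" if "0 < x" "0 < y" for x y :: real
    using that by (auto simp: max_def field_simps)
  have "hinge I (\<lambda>_. 1) u n \<tau> = (\<Sum>xs\<in>tuples I n. exp (sm u xs) - exp (n * \<tau>)
      + exp (n * \<tau>) * (exp (sm u xs) * max 0 (exp (- sm u xs) - exp (- (n * \<tau>)))))"
    unfolding hinge_def by (intro sum.cong refl) (simp add: *[of "exp _" "exp _"] exp_minus divide_inverse)
  then show ?thesis
    by (simp add: hinge_def sum.distrib sum_subtractf sum_exp_tuples sum_const_tuples pr_exp sm_uminus
        mult.commute del: sum_constant flip: sum_distrib_left)
qed

text \<open>Duality reflects \<open>s\<close> to \<open>1 - s\<close>, so that statements about
  \<open>s > 1\<close> for the dual measure are statements about \<open>s < 0\<close> for the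
  original one.\<close>

lemma mgf_dual: "mgf I (\<lambda>i. exp (u i)) (\<lambda>i. - u i) s = mgf I (\<lambda>_. 1) u (1 - s)"
  by (simp add: mgf_def left_diff_distrib exp_diff exp_minus divide_inverse)

lemma mgf'_dual: "mgf' I (\<lambda>i. exp (u i)) (\<lambda>i. - u i) s = - mgf' I (\<lambda>_. 1) u (1 - s)"
  by (simp add: mgf'_def left_diff_distrib exp_diff exp_minus divide_inverse sum_negf) (simp add: mult_ac)

lemma mgf_1_0: "mgf I (\<lambda>_. 1) u 0 = card I"
  by (simp add: mgf_def)

text \<open>Finitely many of the neighbourhoods cover \<open>K\<close>, and finitely many eventual
  properties hold simultaneously.\<close>

lemma eventually_ball_compact:
  fixes K :: "real set"
  assumes K: "compact K"
    and loc: "\<And>x. x \<in> K \<Longrightarrow> \<exists>\<epsilon>>0. eventually (\<lambda>n. \<forall>y. \<bar>y - x\<bar> < \<epsilon> \<longrightarrow> P n y) F"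
  shows "eventually (\<lambda>n. \<forall>y\<in>K. P n y) F"
proof -
  from loc have "\<forall>x\<in>K. \<exists>\<epsilon>>0. eventually (\<lambda>n. \<forall>y. \<bar>y - x\<bar> < \<epsilon> \<longrightarrow> P n y) F" by blast
  from bchoice[OF this] obtain e
    where e: "\<And>x. x \<in> K \<Longrightarrow> 0 < e x \<and> eventually (\<lambda>n. \<forall>y. \<bar>y - x\<bar> < e x \<longrightarrow> P n y) F" by blast
  obtain D where D: "D \<subseteq> K" "finite D" "K \<subseteq> (\<Union>x\<in>D. {x - e x<..<x + e x})"
  proof (rule compactE_image[OF K, of K "\<lambda>x. {x - e x<..<x + e x}"])
    show "K \<subseteq> (\<Union>x\<in>K. {x - e x<..<x + e x})" using e by force
  qed auto
  have "eventually (\<lambda>n. \<forall>x\<in>D. \<forall>y. \<bar>y - x\<bar> < e x \<longrightarrow> P n y) F"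
    using D(1,2) e by (intro eventually_ball_finite) blast+
  then show ?thesis
  proof eventually_elim
    case (elim n)
    show ?case
    proof
      fix y assume "y \<in> K"
      then obtain x where "x \<in> D" "y \<in> {x - e x<..<x + e x}" using D(3) by blast
      moreover then have "\<bar>y - x\<bar> < e x" by auto
      ultimately show "P n y" using elim by blast
    qed
  qed
qed

lemma sm_le:
  assumes "xs \<in> tuples I n" "\<And>i. i \<in> I \<Longrightarrow> u i \<le> m"
  shows "sm u xs \<le> n * (m :: real)"
proof -
  have "set xs \<subseteq> I \<Longrightarrow> sm u xs \<le> length xs * m"
    using assms(2) by (induction xs) (auto simp: distrib_right add_mono)
  then show ?thesis using assms(1) by (simp add: tuples_def)
qed

lemma hinge_eq_0:
  assumes "\<And>i. i \<in> I \<Longrightarrow> u i \<le> \<tau>"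
  shows "hinge I b u n \<tau> = 0"
  unfolding hinge_def using sm_le[where u = u and m = \<tau>] assms by (intro sum.neutral) auto

lemma hinge_nonneg: "(\<And>i. i \<in> I \<Longrightarrow> 0 \<le> b i) \<Longrightarrow> 0 \<le> hinge I b u n \<tau>"
  unfolding hinge_def by (intro sum_nonneg mult_nonneg_nonneg pr_nonneg[of I b]) auto

text \<open>In the dual form the dual hinge of \<open>I\<close> is non-negative, so it suffices that
  the dual hinge of \<open>J\<close> plus \<open>card I ^ n\<close> is at most
  \<open>card J ^ n\<close>. The dual hinge of \<open>J\<close> grows at a rate strictly below
  \<open>card J\<close>.\<close>

lemma hinge_le_hinge_eventually_if_card_less:
  fixes t :: real
  assumes fin: "finite I" "finite J" and I: "I \<noteq> {}"
    and u: "mgf I (\<lambda>_. 1) u 1 = 1" and w: "mgf J (\<lambda>_. 1) w 1 = 1"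
    and card: "card I < card J" and t: "t * card J < mgf' J (\<lambda>_. 1) w 0"
  shows "\<exists>\<epsilon>>0. \<forall>\<^sub>F n in sequentially. \<forall>\<tau>. \<bar>\<tau> - t\<bar> < \<epsilon> \<longrightarrow>
    hinge J (\<lambda>_. 1) w n \<tau> \<le> hinge I (\<lambda>_. 1) u n \<tau>"
proof -
  let ?c = "\<lambda>j. exp (w j)" and ?w = "\<lambda>j. - w j"
  have J: "J \<noteq> {}" "0 < card I" using card I fin by (auto simp: card_gt_0_iff)
  \<comment> \<open>The Chernoff rate equals \<open>card J\<close> at exponent 1, and the hypothesis
    on \<open>t\<close> says that its slope there is negative, so an exponent slightly above 1 gives
    a smaller rate.\<close>
  have "((\<lambda>s. mgf J ?c ?w (1 + s) * exp (s * t)) has_real_derivative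
      (mgf' J ?c ?w (1 + 0) * exp (0 * t) + mgf J ?c ?w (1 + 0) * (exp (0 * t) * t))) (at 0)"
    by (rule derivative_eq_intros DERIV_chain2[OF mgf_deriv] refl)+ simp
  moreover have "mgf' J ?c ?w (1 + 0) * exp (0 * t) + mgf J ?c ?w (1 + 0) * (exp (0 * t) * t) < 0"
    using t unfolding mgf_dual mgf'_dual by (simp add: mgf_1_0 mult.commute)
  ultimately obtain d :: real where "0 < d" and d: "\<And>h. 0 < h \<Longrightarrow> h < d \<Longrightarrow>
      mgf J ?c ?w (1 + (0 + h)) * exp ((0 + h) * t) < mgf J ?c ?w (1 + 0) * exp (0 * t)"
    using DERIV_neg_dec_right by blast
  define s where "s = 1 + d / 2"
  have s: "1 < s" using \<open>0 < d\<close> by (simp add: s_def)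
  have "mgf J ?c ?w s * exp ((1 - s) * (- t)) < card J"
    using d[of "d / 2"] \<open>0 < d\<close> by (simp add: s_def mgf_dual[of J w 1] mgf_1_0)
  then obtain K where K: "mgf J ?c ?w s * exp ((1 - s) * (- t)) < K" "K < card J"
    using dense by blast
  have Mpos: "0 < mgf J ?c ?w s" using fin J by (intro mgf_pos) auto
  have K0: "0 < K" using K(1) Mpos by (smt (verit) mult_pos_pos exp_gt_zero)
  have "((\<lambda>\<tau>. mgf J ?c ?w s * exp ((1 - s) * (- \<tau>))) \<longlongrightarrow> mgf J ?c ?w s * exp ((1 - s) * (- t))) (nhds t)"
    by (intro tendsto_intros filterlim_ident)
  then have "\<forall>\<^sub>F \<tau> in nhds t. mgf J ?c ?w s * exp ((1 - s) * (- \<tau>)) < K"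
    using K(1) by (rule order_tendstoD)
  then obtain \<epsilon> where \<epsilon>: "0 < \<epsilon>"
      "\<And>\<tau>. \<bar>\<tau> - t\<bar> < \<epsilon> \<Longrightarrow> mgf J ?c ?w s * exp ((1 - s) * (- \<tau>)) < K"
    unfolding eventually_nhds_metric dist_real_def by blast
  \<comment> \<open>Each of the two summands takes up at most half of
    \<open>card J ^ n\<close>.\<close>
  have "\<forall>\<^sub>F n in sequentially. K ^ n \<le> (1 / 2) * real (card J) ^ n"
    using K K0 by (intro eventually_const_mult_power_le) auto
  moreover have "\<forall>\<^sub>F n in sequentially. real (card I) ^ n \<le> (1 / 2) * real (card J) ^ n"
    using card J by (intro eventually_const_mult_power_le) auto
  ultimately have "\<forall>\<^sub>F n in sequentially. \<forall>\<tau>. \<bar>\<tau> - t\<bar> < \<epsilon> \<longrightarrow>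
    hinge J (\<lambda>_. 1) w n \<tau> \<le> hinge I (\<lambda>_. 1) u n \<tau>"
  proof eventually_elim
    case (elim n)
    show ?case
    proof (intro allI impI)
      fix \<tau> assume \<tau>: "\<bar>\<tau> - t\<bar> < \<epsilon>"
      have "hinge J ?c ?w n (- \<tau>) \<le> (mgf J ?c ?w s * exp ((1 - s) * (- \<tau>))) ^ n"
        using s by (intro hinge_le) auto
      also have "\<dots> \<le> K ^ n"
        using \<epsilon>(2)[OF \<tau>] Mpos by (intro power_mono) auto
      finally have "hinge J ?c ?w n (- \<tau>) + real (card I) ^ n \<le> real (card J) ^ n"
        using elim by simp
      then have "exp (n * \<tau>) * (hinge J ?c ?w n (- \<tau>) + real (card I) ^ n) \<le> exp (n * \<tau>) * real (card J) ^ n"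
        by (intro mult_left_mono) auto
      moreover have "0 \<le> exp (n * \<tau>) * hinge I (\<lambda>i. exp (u i)) (\<lambda>i. - u i) n (- \<tau>)"
        by (intro mult_nonneg_nonneg hinge_nonneg) auto
      ultimately show "hinge J (\<lambda>_. 1) w n \<tau> \<le> hinge I (\<lambda>_. 1) u n \<tau>"
        unfolding hinge_eq_dual u w by (simp add: algebra_simps)
    qed
  qed
  with \<epsilon>(1) show ?thesis by blast
qed

text \<open>\<open>low\<close> has two alternatives: a smaller \<open>card I\<close> settles the low
  thresholds by counting alone, whereas equal cardinalities call for the comparison of the dual
  measures.\<close>

lemma hinge_le_hinge_eventually:
  assumes fin: "finite I" "finite J" and I: "I \<noteq> {}"
    and u: "mgf I (\<lambda>_. 1) u 1 = 1" and w: "mgf J (\<lambda>_. 1) w 1 = 1"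
    and gt1: "\<And>s. 1 < s \<Longrightarrow> mgf J (\<lambda>_. 1) w s < mgf I (\<lambda>_. 1) u s"
    and btw: "\<And>s. 0 < s \<Longrightarrow> s < 1 \<Longrightarrow> mgf I (\<lambda>_. 1) u s < mgf J (\<lambda>_. 1) w s"
    and ent: "mgf' J (\<lambda>_. 1) w 1 < mgf' I (\<lambda>_. 1) u 1"
    and max: "\<exists>i\<in>I. \<forall>j\<in>J. w j < u i"
    and low: "card I < card J \<or> card I = card J
      \<and> (\<forall>s<0. mgf J (\<lambda>_. 1) w s < mgf I (\<lambda>_. 1) u s)
      \<and> mgf' I (\<lambda>_. 1) u 0 < mgf' J (\<lambda>_. 1) w 0 \<and> (\<exists>i\<in>I. \<forall>j\<in>J. u i < w j)"
  shows "\<forall>\<^sub>F n in sequentially. \<forall>\<tau>. hinge J (\<lambda>_. 1) w n \<tau> \<le> hinge I (\<lambda>_. 1) u n \<tau>"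
proof -
  have J: "J \<noteq> {}" using w by (auto simp: mgf_def)
  have cardle: "card I \<le> card J" using low by auto
  let ?K = "{Min (w ` J)..Max (w ` J)}"
  have "\<forall>\<^sub>F n in sequentially. \<forall>\<tau>\<in>?K. hinge J (\<lambda>_. 1) w n \<tau> \<le> hinge I (\<lambda>_. 1) u n \<tau>"
  proof (rule eventually_ball_compact)
    fix t assume t: "t \<in> ?K"
    \<comment> \<open>The regimes are separated by the means of \<open>w\<close> under the weights
      \<open>exp (w j)\<close>, which is \<open>mgf'\<close> at 1, and under the uniform weights,
      which is \<open>mgf'\<close> at 0 divided by \<open>card J\<close>.\<close>
    consider (high) "mgf' J (\<lambda>_. 1) w 1 < t" | (less) "t * card J < mgf' J (\<lambda>_. 1) w 0" "card I < card J"
      | (eq) "t * card J < mgf' J (\<lambda>_. 1) w 0" "card I = card J"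
      | (mid) "mgf' J (\<lambda>_. 1) w 0 \<le> t * card J" "t \<le> mgf' J (\<lambda>_. 1) w 1"
      using cardle by linarith
    then show "\<exists>\<epsilon>>0. \<forall>\<^sub>F n in sequentially. \<forall>\<tau>. \<bar>\<tau> - t\<bar> < \<epsilon> \<longrightarrow>
      hinge J (\<lambda>_. 1) w n \<tau> \<le> hinge I (\<lambda>_. 1) u n \<tau>"
    proof cases
      case high
      obtain i where i: "i \<in> I" "\<forall>j\<in>J. w j < u i" using max by blast
      have "Max (w ` J) < u i" using i fin J by simp
      then have "\<exists>i\<in>I. t < u i" using t i(1) by (intro bexI[of _ i]) auto
      then show ?thesis using high u w gt1
        by (intro hinge_le_hinge_near fin) auto
    next
      case less
      then show ?thesis using fin I u w by (intro hinge_le_hinge_eventually_if_card_less)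
    next
      case mid
      have "\<exists>\<epsilon>>0. \<forall>\<^sub>F n in sequentially. \<forall>\<tau>. \<bar>\<tau> - t\<bar> < \<epsilon> \<longrightarrow>
          trunc I (\<lambda>_. 1) u n \<tau> \<le> trunc J (\<lambda>_. 1) w n \<tau>"
      proof (rule trunc_le_trunc_near[OF fin I J])
        \<comment> \<open>With equal cardinalities the slope of \<open>I\<close> at 0 lies below
          that of \<open>J\<close>, hence below \<open>t * card I\<close>. Otherwise the values at 0
          already differ strictly.\<close>
        show "mgf' I (\<lambda>_. 1) u 0 < t * mgf I (\<lambda>_. 1) u 0 \<or> mgf I (\<lambda>_. 1) u 0 < mgf J (\<lambda>_. 1) w 0"
          using low mid unfolding mgf_1_0 by auto
      qed (use u w mid ent btw cardle in \<open>auto simp: mgf_1_0\<close>)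
      then show ?thesis unfolding hinge_eq_trunc u w by simp
    next
      case eq
      obtain i where i: "i \<in> I" "\<forall>j\<in>J. u i < w j" using low eq by auto
      have "u i < Min (w ` J)" using i fin J by simp
      then have "\<exists>i\<in>I. - t < - u i" using t i(1) by (intro bexI[of _ i]) auto
      \<comment> \<open>The high-threshold comparison for the dual measures at \<open>- t\<close>:
        their masses at exponent 1 are the equal cardinalities, and exponents above 1 come from
        negative \<open>s\<close>.\<close>
      then have "\<exists>\<epsilon>>0. \<forall>\<^sub>F n in sequentially. \<forall>\<tau>. \<bar>\<tau> - (- t)\<bar> < \<epsilon> \<longrightarrow>
          hinge J (\<lambda>j. exp (w j)) (\<lambda>j. - w j) n \<tau> \<le> hinge I (\<lambda>i. exp (u i)) (\<lambda>i. - u i) n \<tau>"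
        using low eq by (intro hinge_le_hinge_near fin) (auto simp: mgf_dual mgf'_dual mgf_1_0)
      then obtain \<epsilon> where \<epsilon>: "0 < \<epsilon>" "\<forall>\<^sub>F n in sequentially. \<forall>\<tau>. \<bar>\<tau> - (- t)\<bar> < \<epsilon> \<longrightarrow>
          hinge J (\<lambda>j. exp (w j)) (\<lambda>j. - w j) n \<tau> \<le> hinge I (\<lambda>i. exp (u i)) (\<lambda>i. - u i) n \<tau>" by blast
      from \<epsilon>(2) have "\<forall>\<^sub>F n in sequentially. \<forall>\<tau>. \<bar>\<tau> - t\<bar> < \<epsilon> \<longrightarrow>
          hinge J (\<lambda>_. 1) w n \<tau> \<le> hinge I (\<lambda>_. 1) u n \<tau>"
      proof eventually_elim
        case (elim n)
        show ?case
        proof (intro allI impI)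
          fix \<tau> assume "\<bar>\<tau> - t\<bar> < \<epsilon>"
          then have "\<bar>- \<tau> - (- t)\<bar> < \<epsilon>" by simp
          with elim have "hinge J (\<lambda>j. exp (w j)) (\<lambda>j. - w j) n (- \<tau>)
              \<le> hinge I (\<lambda>i. exp (u i)) (\<lambda>i. - u i) n (- \<tau>)" by blast
          then show "hinge J (\<lambda>_. 1) w n \<tau> \<le> hinge I (\<lambda>_. 1) u n \<tau>"
            unfolding hinge_eq_dual u w eq(2) by simp
        qed
      qed
      with \<epsilon>(1) show ?thesis by blast
    qed
  qed simp
  then show ?thesis
  proof eventually_elim
    case (elim n)
    show ?case
    proof
      fix \<tau>
      consider "\<tau> \<in> ?K" | "Max (w ` J) < \<tau>" | "\<tau> < Min (w ` J)" by force
      then show "hinge J (\<lambda>_. 1) w n \<tau> \<le> hinge I (\<lambda>_. 1) u n \<tau>"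
      proof cases
        case 2
        have "w j \<le> Max (w ` J)" if "j \<in> J" for j using that fin by simp
        with 2 have "hinge J (\<lambda>_. 1) w n \<tau> = 0" by (intro hinge_eq_0) force
        then show ?thesis using hinge_nonneg[of I "\<lambda>_. 1"] by simp
      next
        case 3
        have "Min (w ` J) \<le> w j" if "j \<in> J" for j using that fin by simp
        \<comment> \<open>Below all entries of \<open>q\<close> the dual hinge of \<open>J\<close>
          vanishes, and the comparison reduces to the cardinalities.\<close>
        with 3 have zero: "hinge J (\<lambda>j. exp (w j)) (\<lambda>j. - w j) n (- \<tau>) = 0"
          by (intro hinge_eq_0) force
        have "0 \<le> exp (n * \<tau>) * hinge I (\<lambda>i. exp (u i)) (\<lambda>i. - u i) n (- \<tau>)"
          by (intro mult_nonneg_nonneg hinge_nonneg) auto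
        moreover have "real (card I) ^ n * exp (n * \<tau>) \<le> real (card J) ^ n * exp (n * \<tau>)"
          using cardle by (intro mult_right_mono power_mono) auto
        ultimately show ?thesis unfolding hinge_eq_dual u w zero by linarith
      qed (use elim in blast)
    qed
  qed
qed

section \<open>Kronecker powers and Renyi divergences\<close>

lemma sum_lessThan_mult:
  fixes f :: "nat \<Rightarrow> nat \<Rightarrow> real"
  shows "(\<Sum>i<a * b. f (i div b) (i mod b)) = (\<Sum>j<a. \<Sum>k<b. f j k)"
proof -
  have "(\<Sum>i<a * b. f (i div b) (i mod b)) = (\<Sum>j<a. \<Sum>i\<in>{j * b..<j * b + b}. f (i div b) (i mod b))"
    by (rule sum.nat_group[symmetric])
  also have "\<dots> = (\<Sum>j<a. \<Sum>k<b. f j k)"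
  proof (rule sum.cong[OF refl])
    fix j
    have "(\<Sum>i\<in>{j * b..<j * b + b}. f (i div b) (i mod b)) = (\<Sum>k<b. f ((k + j * b) div b) ((k + j * b) mod b))"
      using sum.shift_bounds_nat_ivl[of "\<lambda>i. f (i div b) (i mod b)" 0 "j * b" b]
      by (simp add: add.commute atLeast0LessThan)
    then show "(\<Sum>i\<in>{j * b..<j * b + b}. f (i div b) (i mod b)) = (\<Sum>k<b. f j k)" by simp
  qed
  finally show ?thesis .
qed

lemma dim_kron_power [simp]: "dim_vec (kron_power v n) = dim_vec v ^ n"
  by (induction n) (simp_all add: kron_def)

text \<open>The function \<open>g\<close> is arbitrary so that the induction can absorb the leading
  factor \<open>v $ j\<close> into it.\<close>

lemma sum_kron_power:
  "(\<Sum>i<dim_vec v ^ n. g (kron_power v n $ i)) = (\<Sum>xs\<in>tuples {..<dim_vec v} n. g (pr (\<lambda>i. v $ i) xs))"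
  for g :: "real \<Rightarrow> real"
proof (induction n arbitrary: g)
  case (Suc n)
  have "(\<Sum>i<dim_vec v ^ Suc n. g (kron_power v (Suc n) $ i))
      = (\<Sum>j<dim_vec v. \<Sum>k<dim_vec v ^ n. g (v $ j * kron_power v n $ k))"
    using sum_lessThan_mult[of "\<lambda>j k. g (v $ j * kron_power v n $ k)" "dim_vec v ^ n" "dim_vec v"]
    by (simp add: kron_def)
  also have "\<dots> = (\<Sum>j<dim_vec v. \<Sum>xs\<in>tuples {..<dim_vec v} n. g (v $ j * pr (\<lambda>i. v $ i) xs))"
    by (intro sum.cong refl Suc.IH)
  finally show ?case by (simp add: sum_tuples_Suc)
qed simp

lemma vsupp_subset: "vsupp v \<subseteq> {..<dim_vec v}"
  by (auto simp: vsupp_def entry_def split: if_splits)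

lemma finite_vsupp [simp]: "finite (vsupp v)"
  using vsupp_subset finite_subset by blast

lemma prob_vec_entry_nonneg: "prob_vec v \<Longrightarrow> 0 \<le> entry v i"
  by (simp add: prob_vec_def entry_def)

lemma prob_vec_entry_pos: "prob_vec v \<Longrightarrow> i \<in> vsupp v \<Longrightarrow> 0 < entry v i"
  using prob_vec_entry_nonneg[of v i] by (simp add: vsupp_def)

lemma sum_eq_sum_vsupp:
  assumes "dim_vec v \<le> N" and "\<And>i. entry v i = 0 \<Longrightarrow> f i = 0"
  shows "(\<Sum>i<N. f i) = (\<Sum>i\<in>vsupp v. f i :: real)"
  using assms vsupp_subset[of v] by (intro sum.mono_neutral_right) (auto simp: vsupp_def)

lemma sum_entry: "prob_vec v \<Longrightarrow> (\<Sum>i\<in>vsupp v. entry v i) = 1"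
  using sum_eq_sum_vsupp[of v "dim_vec v" "entry v"] by (simp add: prob_vec_def entry_def)

abbreviation lentry :: "real vec \<Rightarrow> nat \<Rightarrow> real" where
  "lentry v i \<equiv> ln (entry v i)"

text \<open>As \<open>g\<close> vanishes at 0, neither the padding nor the tuples that leave the
  support contribute. On the support the entries are positive, so products become exponentials of
  sums of logarithms.\<close>

lemma sum_entry_kron_power:
  assumes v: "prob_vec v" and N: "dim_vec v ^ n \<le> N" and g: "g 0 = (0 :: real)"
  shows "(\<Sum>i<N. g (entry (kron_power v n) i)) = (\<Sum>xs\<in>tuples (vsupp v) n. g (exp (sm (lentry v) xs)))"
proof -
  have "(\<Sum>i<N. g (entry (kron_power v n) i)) = (\<Sum>i<dim_vec v ^ n. g (entry (kron_power v n) i))"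
    using N g by (intro sum.mono_neutral_right) (auto simp: entry_def)
  also have "\<dots> = (\<Sum>i<dim_vec v ^ n. g (kron_power v n $ i))"
    by (intro sum.cong) (auto simp: entry_def)
  also have "\<dots> = (\<Sum>xs\<in>tuples {..<dim_vec v} n. g (pr (\<lambda>i. v $ i) xs))" by (rule sum_kron_power)
  also have "\<dots> = (\<Sum>xs\<in>tuples (vsupp v) n. g (pr (\<lambda>i. v $ i) xs))"
  proof (rule sum.mono_neutral_right)
    show "tuples (vsupp v) n \<subseteq> tuples {..<dim_vec v} n" using vsupp_subset[of v] by (auto simp: tuples_def)
    show "\<forall>xs\<in>tuples {..<dim_vec v} n - tuples (vsupp v) n. g (pr (\<lambda>i. v $ i) xs) = 0"
    proof
      fix xs assume xs: "xs \<in> tuples {..<dim_vec v} n - tuples (vsupp v) n"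
      then obtain i where i: "i \<in> set xs" "i \<notin> vsupp v" by (auto simp: tuples_def)
      then have "v $ i = 0" using xs by (auto simp: vsupp_def entry_def tuples_def)
      with i have "pr (\<lambda>i. v $ i) xs = 0" by (force simp: prod_list_zero_iff)
      then show "g (pr (\<lambda>i. v $ i) xs) = 0" using g by simp
    qed
  qed simp
  also have "\<dots> = (\<Sum>xs\<in>tuples (vsupp v) n. g (exp (sm (lentry v) xs)))"
  proof (rule sum.cong[OF refl])
    fix xs assume "xs \<in> tuples (vsupp v) n"
    then have "set xs \<subseteq> vsupp v" by (simp add: tuples_def)
    then have "pr (\<lambda>i. v $ i) xs = pr (\<lambda>i. exp (lentry v i)) xs"
    proof (induction xs)
      case (Cons i xs)
      then have "v $ i = entry v i" using vsupp_subset[of v] by (auto simp: entry_def)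
      then show ?case using Cons prob_vec_entry_pos[OF v, of i] by simp
    qed simp
    then show "g (pr (\<lambda>i. v $ i) xs) = g (exp (sm (lentry v) xs))" by (simp only: pr_exp)
  qed
  finally show ?thesis .
qed

section \<open>Power sums as moment generating functions of the log entries\<close>

abbreviation power_sum :: "real vec \<Rightarrow> real \<Rightarrow> real" where
  "power_sum v \<equiv> mgf (vsupp v) (\<lambda>_. 1) (lentry v)"

lemma power_sum_eq: "prob_vec v \<Longrightarrow> power_sum v s = (\<Sum>i\<in>vsupp v. entry v i powr s)"
  unfolding mgf_def by (intro sum.cong) (use prob_vec_entry_pos in \<open>force simp: powr_def\<close>)+

lemma power_sum_1: "prob_vec v \<Longrightarrow> power_sum v 1 = 1"
  unfolding mgf_def by (subst sum_entry[symmetric, of v]) (auto intro!: sum.cong simp: prob_vec_entry_pos)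

lemma vsupp_nonempty: "prob_vec v \<Longrightarrow> vsupp v \<noteq> {}"
  using sum_entry[of v] by auto

lemma power_sum_pos: "prob_vec v \<Longrightarrow> 0 < power_sum v s"
  using vsupp_nonempty by (intro mgf_pos) auto

lemma power_sum_deriv_0: "mgf' (vsupp v) (\<lambda>_. 1) (lentry v) 0 = (\<Sum>i\<in>vsupp v. lentry v i)"
  by (simp add: mgf'_def)

lemma power_sum_deriv_1: "prob_vec v \<Longrightarrow> mgf' (vsupp v) (\<lambda>_. 1) (lentry v) 1 = (\<Sum>i\<in>vsupp v. entry v i * lentry v i)"
  unfolding mgf'_def by (intro sum.cong) (auto simp: prob_vec_entry_pos)

lemma majorizes_kron_power_if_hinge_le:
  assumes p: "prob_vec p" and q: "prob_vec q" and n: "0 < n"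
    and le: "\<forall>\<tau>. hinge (vsupp q) (\<lambda>_. 1) (lentry q) n \<tau> \<le> hinge (vsupp p) (\<lambda>_. 1) (lentry p) n \<tau>"
  shows "majorizes (kron_power p n) (kron_power q n)"
proof -
  define N where "N = max (dim_vec (kron_power p n)) (dim_vec (kron_power q n))"
  have Np: "dim_vec p ^ n \<le> N" and Nq: "dim_vec q ^ n \<le> N" by (auto simp: N_def)
  have total: "(\<Sum>i<N. entry (kron_power v n) i) = 1" if "prob_vec v" "dim_vec v ^ n \<le> N" for v
    using sum_entry_kron_power[OF that, of "\<lambda>y. y"] power_sum_1[OF that(1)] by (simp add: sum_exp_tuples)
  show ?thesis
  proof (rule majorizes_if_hinge_sums_le[OF N_def])
    fix t :: real
    show "(\<Sum>i<N. max 0 (entry (kron_power q n) i - t)) \<le> (\<Sum>i<N. max 0 (entry (kron_power p n) i - t))"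
    proof (cases "0 < t")
      case True
      \<comment> \<open>A positive threshold is \<open>exp (n * \<tau>)\<close> with \<tau> =
        \<open>ln t / n\<close>.\<close>
      have "(\<Sum>i<N. max 0 (entry (kron_power v n) i - t)) = hinge (vsupp v) (\<lambda>_. 1) (lentry v) n (ln t / n)"
        if "prob_vec v" "dim_vec v ^ n \<le> N" for v
        using sum_entry_kron_power[OF that, of "\<lambda>y. max 0 (y - t)"] True n by (simp add: hinge_def)
      then show ?thesis using p q Np Nq le by simp
    next
      case False
      have "(\<Sum>i<N. max 0 (entry (kron_power v n) i - t)) = 1 - N * t"
        if v: "prob_vec v" "dim_vec v ^ n \<le> N" for v
      proof -
        \<comment> \<open>For negative \<open>t\<close> the hinge does not vanish at 0, so zero
          entries would count. Adding \<open>t - y\<close> repairs this and gives a function that is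
          0 at every \<open>y \<ge> 0\<close>.\<close>
        let ?g = "\<lambda>y. max 0 (y - t) + t - y"
        have "(\<Sum>i<N. ?g (entry (kron_power v n) i)) = (\<Sum>xs\<in>tuples (vsupp v) n. ?g (exp (sm (lentry v) xs)))"
          using False by (intro sum_entry_kron_power v) auto
        also have "\<dots> = 0"
          using False by (intro sum.neutral) (auto simp: max_def not_less intro: order_trans[of _ 0])
        finally show ?thesis using total[OF v] by (simp add: sum.distrib sum_subtractf)
      qed
      then show ?thesis using p q Np Nq by simp
    qed
  next
    show "(\<Sum>i<N. entry (kron_power q n) i) = (\<Sum>i<N. entry (kron_power p n) i)"
      using total p q Np Nq by simp
  qed
qed

section \<open>From Renyi divergences relative to the uniform vector to power sums\<close>

lemma renyi_div_ne_infinity_imp: "1 \<le> \<alpha> \<Longrightarrow> renyi_div base \<alpha> a b \<noteq> \<infinity> \<Longrightarrow> vsupp a \<subseteq> vsupp b"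
  by (auto simp: renyi_div_def Let_def split: if_splits)

lemma log_scaled_less_iff:
  assumes "1 < base" "0 < c" "0 < x" "0 < y"
  shows "log base (c * x) < log base (c * y) \<longleftrightarrow> x < y"
  using assms by simp

theorem corollary46:
  fixes base :: real and p q u :: "real Matrix.vec"
  assumes "base > 1"
    and "prob_vec p" and "prob_vec q"
    and "u = uniform_vec (max (dim_vec p) (dim_vec q)) (vsupp p \<union> vsupp q)"
    and "\<And>\<alpha>::ereal. ereal (1/2) \<le> \<alpha> \<Longrightarrow> renyi_div base \<alpha> p u > renyi_div base \<alpha> q u"
    and "\<And>\<alpha>::ereal. ereal (1/2) \<le> \<alpha> \<Longrightarrow> renyi_div base \<alpha> u p > renyi_div base \<alpha> u q"
  shows "\<forall>\<^sub>F n in sequentially. majorizes (kron_power p n) (kron_power q n)"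
proof -
  note base = assms(1) and p = assms(2) and q = assms(3)
  define I where "I = vsupp p \<union> vsupp q"
  define N where "N = max (dim_vec p) (dim_vec q)"
  define d where "d = real (card I)"
  have finI: "finite I" by (simp add: I_def)
  have I: "I \<noteq> {}" "I \<subseteq> {..<N}"
    using vsupp_nonempty[OF p] vsupp_subset[of p] vsupp_subset[of q] by (auto simp: I_def N_def)
  have d: "0 < d" using I finI by (auto simp: d_def card_gt_0_iff)
  have u: "u = uniform_vec N I" using assms(4) by (simp add: I_def N_def)
  have dimu: "dim_vec u = N" by (simp add: u uniform_vec_def)
  have eu: "entry u i = (if i \<in> I then 1 / d else 0)" for i
    using I(2) by (auto simp: u uniform_vec_def entry_def d_def)
  have su: "vsupp u = I" using d by (auto simp: vsupp_def eu)
  have dims: "max (dim_vec p) (dim_vec u) = N" "max (dim_vec q) (dim_vec u) = N"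
      "max (dim_vec u) (dim_vec p) = N" "max (dim_vec u) (dim_vec q) = N"
    unfolding dimu by (auto simp: N_def)
  \<comment> \<open>A strict upper bound makes the divergence of \<open>u\<close> from
    \<open>q\<close> at order 1 finite, which forces \<open>q\<close> to have full support.\<close>
  have qI: "vsupp q = I"
  proof -
    have "renyi_div base 1 u q < renyi_div base 1 u p"
      by (rule assms(6)) (simp add: one_ereal_def)
    then have "renyi_div base 1 u q \<noteq> \<infinity>" by auto
    then have "vsupp u \<subseteq> vsupp q" by (rule renyi_div_ne_infinity_imp[rotated]) simp
    then show ?thesis by (auto simp: su I_def)
  qed
  have pI: "vsupp p \<subseteq> I" by (auto simp: I_def)
  have Np: "dim_vec p \<le> N" and Nq: "dim_vec q \<le> N" by (auto simp: N_def)
  \<comment> \<open>The uniform entries \<open>1 / d\<close> contribute only a constant factor,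
    common to \<open>p\<close> and \<open>q\<close>, so order r of the divergence from
    \<open>u\<close> encodes the power sum at r. With the arguments exchanged it encodes the power
    sum at 1 - r.\<close>
  have pow1: "(\<Sum>i<N. entry v i powr r * entry u i powr (1 - r)) = d powr (r - 1) * power_sum v r"
    if "prob_vec v" "dim_vec v \<le> N" "vsupp v \<subseteq> I" for v r
  proof -
    have "(\<Sum>i<N. entry v i powr r * entry u i powr (1 - r))
        = (\<Sum>i\<in>vsupp v. entry v i powr r * entry u i powr (1 - r))"
      using that by (intro sum_eq_sum_vsupp) auto
    also have "\<dots> = (\<Sum>i\<in>vsupp v. d powr (r - 1) * entry v i powr r)"
      using that d powr_minus_divide[of d "1 - r"] by (intro sum.cong) (auto simp: eu powr_divide)
    finally show ?thesis using that by (simp add: power_sum_eq sum_distrib_left)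
  qed
  have pow2: "(\<Sum>i<N. entry u i powr r * entry v i powr (1 - r)) = d powr (- r) * power_sum v (1 - r)"
    if "prob_vec v" "dim_vec v \<le> N" "vsupp v \<subseteq> I" for v r
    using pow1[OF that, of "1 - r"] by (simp add: mult.commute)
  note pows = pow1[OF p Np pI] pow1[OF q Nq] pow2[OF p Np pI] pow2[OF q Nq]
  have nonempty: "vsupp p \<inter> I \<noteq> {}" "I \<inter> vsupp p \<noteq> {}" using vsupp_nonempty[OF p] pI by auto
  have gt1: "power_sum q r < power_sum p r" if r: "1 < r" for r
  proof -
    have "renyi_div base (ereal r) q u < renyi_div base (ereal r) p u"
      using r by (intro assms(5)) auto
    then have "1 / (r - 1) * log base (d powr (r - 1) * power_sum q r) < 1 / (r - 1) * log base (d powr (r - 1) * power_sum p r)"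
      using r pI qI by (simp add: renyi_div_def Let_def dims pows su)
    then have "log base (d powr (r - 1) * power_sum q r) < log base (d powr (r - 1) * power_sum p r)"
      using r by (simp add: divide_less_cancel)
    then show ?thesis
      using base d power_sum_pos[OF p, of r] power_sum_pos[OF q, of r] by (subst (asm) log_scaled_less_iff) auto
  qed
  have btw1: "power_sum p r < power_sum q r" if r: "1 / 2 \<le> r" "r < 1" for r
  proof -
    have "renyi_div base (ereal r) q u < renyi_div base (ereal r) p u"
      using r by (intro assms(5)) auto
    then have "1 / (r - 1) * log base (d powr (r - 1) * power_sum q r) < 1 / (r - 1) * log base (d powr (r - 1) * power_sum p r)"
      using r qI I nonempty by (simp add: renyi_div_def Let_def dims pows su)
    \<comment> \<open>The factor \<open>1 / (r - 1)\<close> is negative for \<open>r < 1\<close>, so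
      clearing it reverses the inequality.\<close>
    then have "log base (d powr (r - 1) * power_sum p r) < log base (d powr (r - 1) * power_sum q r)"
      using r by (simp add: divide_less_cancel)
    then show ?thesis
      using base d power_sum_pos[OF p, of r] power_sum_pos[OF q, of r] by (subst (asm) log_scaled_less_iff) auto
  qed
  have btw2: "power_sum p (1 - r) < power_sum q (1 - r)" if r: "1 / 2 \<le> r" "r < 1" for r
  proof -
    have "renyi_div base (ereal r) u q < renyi_div base (ereal r) u p"
      using r by (intro assms(6)) auto
    then have "1 / (r - 1) * log base (d powr (- r) * power_sum q (1 - r)) < 1 / (r - 1) * log base (d powr (- r) * power_sum p (1 - r))"
      using r qI I nonempty by (simp add: renyi_div_def Let_def dims pows su)
    then have "log base (d powr (- r) * power_sum p (1 - r)) < log base (d powr (- r) * power_sum q (1 - r))"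
      using r by (simp add: divide_less_cancel)
    then show ?thesis
      using base d power_sum_pos[OF p, of "1 - r"] power_sum_pos[OF q, of "1 - r"] by (subst (asm) log_scaled_less_iff) auto
  qed
  \<comment> \<open>Orders from 1/2 upwards suffice: one family of divergences covers [1/2, 1), and
    the other, through the reflection to \<open>1 - r\<close>, covers (0, 1/2].\<close>
  have btw: "power_sum p s < power_sum q s" if "0 < s" "s < 1" for s
    using btw1[of s] btw2[of "1 - s"] that by (cases "1 / 2 \<le> s") auto
  \<comment> \<open>Order 1 compares the derivatives of the power sums at 1, that is, the negative
    Shannon entropies.\<close>
  have ent: "(\<Sum>i\<in>vsupp q. entry q i * lentry q i) < (\<Sum>i\<in>vsupp p. entry p i * lentry p i)"
  proof -
    have *: "(\<Sum>i<N. entry v i * log base (entry v i / entry u i))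
        = log base d + (\<Sum>i\<in>vsupp v. entry v i * lentry v i) / ln base"
      if v: "prob_vec v" "dim_vec v \<le> N" "vsupp v \<subseteq> I" for v
    proof -
      have "(\<Sum>i<N. entry v i * log base (entry v i / entry u i))
          = (\<Sum>i\<in>vsupp v. entry v i * log base (entry v i / entry u i))"
        using v by (intro sum_eq_sum_vsupp) auto
      also have "\<dots> = (\<Sum>i\<in>vsupp v. entry v i * log base d + entry v i * lentry v i / ln base)"
      proof (rule sum.cong[OF refl])
        fix i assume i: "i \<in> vsupp v"
        then have "0 < entry v i" "entry u i = 1 / d" using v prob_vec_entry_pos by (auto simp: eu)
        then show "entry v i * log base (entry v i / entry u i) = entry v i * log base d + entry v i * lentry v i / ln base"
          using d by (simp add: log_def ln_mult distrib_left add_divide_distrib)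
      qed
      also have "\<dots> = log base d + (\<Sum>i\<in>vsupp v. entry v i * lentry v i) / ln base"
        using sum_entry[OF v(1)] by (simp add: sum.distrib flip: sum_distrib_right sum_divide_distrib)
      finally show ?thesis .
    qed
    have "renyi_div base 1 q u < renyi_div base 1 p u"
      by (rule assms(5)) (simp add: one_ereal_def)
    then have "(\<Sum>i<N. entry q i * log base (entry q i / entry u i)) < (\<Sum>i<N. entry p i * log base (entry p i / entry u i))"
      using pI qI by (simp add: renyi_div_def Let_def dims su)
    then show ?thesis
      using *[OF p Np pI] *[OF q Nq] qI base by (simp add: divide_less_cancel)
  qed
  have max: "\<exists>i\<in>vsupp p. \<forall>j\<in>vsupp q. lentry q j < lentry p i"
  proof -
    have "renyi_div base \<infinity> q u < renyi_div base \<infinity> p u"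
      by (rule assms(5)) simp
    then have less: "Max ((\<lambda>i. elog base (entry q i / entry u i)) ` I) < Max ((\<lambda>i. elog base (entry p i / entry u i)) ` I)"
      using pI qI by (simp add: renyi_div_def Let_def su)
    have "Max ((\<lambda>i. elog base (entry p i / entry u i)) ` I) \<in> (\<lambda>i. elog base (entry p i / entry u i)) ` I"
      using finI I by (intro Max_in) auto
    then obtain i where i: "i \<in> I" "Max ((\<lambda>i. elog base (entry p i / entry u i)) ` I) = elog base (entry p i / entry u i)"
      by blast
    have lt: "elog base (entry q j / entry u j) < elog base (entry p i / entry u i)" if "j \<in> I" for j
      using less finI that I unfolding i(2) by simp
    \<comment> \<open>The value at \<open>i\<close> strictly exceeds another one, so it is not the
      -\<infinity> assigned to a zero entry.\<close>
    have "entry p i \<noteq> 0" using lt[OF i(1)] by (auto simp: elog_def)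
    then have ip: "i \<in> vsupp p" by (simp add: vsupp_def)
    moreover have "lentry q j < lentry p i" if j: "j \<in> vsupp q" for j
    proof -
      have "0 < entry q j" "0 < entry p i" using prob_vec_entry_pos p q j ip by auto
      moreover then have "log base (entry q j * d) < log base (entry p i * d)"
        using lt[of j] j qI i(1) d by (simp add: elog_def eu)
      ultimately show ?thesis using d base by simp
    qed
    ultimately show ?thesis by blast
  qed
  have low: "card (vsupp p) < card (vsupp q) \<or> card (vsupp p) = card (vsupp q)
      \<and> (\<forall>s<0. power_sum q s < power_sum p s)
      \<and> (\<Sum>i\<in>vsupp p. lentry p i) < (\<Sum>i\<in>vsupp q. lentry q i)
      \<and> (\<exists>i\<in>vsupp p. \<forall>j\<in>vsupp q. lentry p i < lentry q j)"
  \<comment> \<open>If \<open>p\<close> lacks full support, its divergences from \<open>u\<close> at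
    orders \<ge> 1 are infinite and only the sizes of the supports compare. Otherwise those orders
    give the conditions at s < 0, at 0 and at -\<infinity>.\<close>
  proof (cases "vsupp p = I")
    case False
    then have "card (vsupp p) < card (vsupp q)" unfolding qI using pI finI by (intro psubset_card_mono) auto
    then show ?thesis ..
  next
    case True
    have "power_sum q s < power_sum p s" if s: "s < 0" for s
    proof -
      define r where "r = 1 - s"
      have r: "1 < r" "s = 1 - r" using s by (auto simp: r_def)
      have "renyi_div base (ereal r) u q < renyi_div base (ereal r) u p"
        using r by (intro assms(6)) auto
      then have "1 / (r - 1) * log base (d powr (- r) * power_sum q s) < 1 / (r - 1) * log base (d powr (- r) * power_sum p s)"
        using r(1) True qI by (simp add: renyi_div_def Let_def dims pows su r(2))
      then have "log base (d powr (- r) * power_sum q s) < log base (d powr (- r) * power_sum p s)"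
        using r by (simp add: divide_less_cancel)
      then show ?thesis
        using base d power_sum_pos[OF p, of s] power_sum_pos[OF q, of s] by (subst (asm) log_scaled_less_iff) auto
    qed
    \<comment> \<open>Order 1 of the divergence of \<open>u\<close> from \<open>v\<close> is an
      affine function, with negative slope, of the derivative of the power sum at 0.\<close>
    moreover have "(\<Sum>i\<in>vsupp p. lentry p i) < (\<Sum>i\<in>vsupp q. lentry q i)"
    proof -
      have *: "(\<Sum>i<N. entry u i * log base (entry u i / entry v i))
          = - log base d - (\<Sum>i\<in>I. lentry v i) / (d * ln base)"
        if v: "prob_vec v" "vsupp v = I" for v
      proof -
        have "(\<Sum>i<N. entry u i * log base (entry u i / entry v i))
            = (\<Sum>i\<in>vsupp u. entry u i * log base (entry u i / entry v i))"
          using dimu by (intro sum_eq_sum_vsupp) auto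
        also have "\<dots> = (\<Sum>i\<in>I. - log base d / d - lentry v i / (d * ln base))"
          unfolding su
        proof (rule sum.cong[OF refl])
          fix i assume i: "i \<in> I"
          then have v0: "0 < entry v i" and ui: "entry u i = 1 / d" using v prob_vec_entry_pos by (auto simp: eu)
          have "ln (1 / d / entry v i) = - ln d - lentry v i" using v0 d by (simp add: ln_div ln_mult)
          then show "entry u i * log base (entry u i / entry v i) = - log base d / d - lentry v i / (d * ln base)"
            unfolding ui log_def using d base by (simp only:) (simp add: field_simps)
        qed
        also have "\<dots> = - log base d - (\<Sum>i\<in>I. lentry v i) / (d * ln base)"
          using d by (simp add: sum_subtractf d_def flip: sum_divide_distrib)
        finally show ?thesis .
      qed
      have "renyi_div base 1 u q < renyi_div base 1 u p"
        by (rule assms(6)) (simp add: one_ereal_def)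
      then have "(\<Sum>i<N. entry u i * log base (entry u i / entry q i)) < (\<Sum>i<N. entry u i * log base (entry u i / entry p i))"
        using True qI by (simp add: renyi_div_def Let_def dims su)
      then have "(\<Sum>i\<in>I. lentry p i) / (d * ln base) < (\<Sum>i\<in>I. lentry q i) / (d * ln base)"
        using *[OF p True] *[OF q qI] by simp
      moreover have "0 < d * ln base" using d base by simp
      ultimately show ?thesis unfolding True qI by (simp only: divide_less_cancel)
    qed
    \<comment> \<open>The maximum of \<open>u / v\<close> is attained at the smallest entry of
      \<open>v\<close>, so order \<infinity> compares the smallest entries.\<close>
    moreover have "\<exists>i\<in>vsupp p. \<forall>j\<in>vsupp q. lentry p i < lentry q j"
    proof -
      have "renyi_div base \<infinity> u q < renyi_div base \<infinity> u p"
        by (rule assms(6)) simp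
      then have less: "Max ((\<lambda>i. elog base (entry u i / entry q i)) ` I) < Max ((\<lambda>i. elog base (entry u i / entry p i)) ` I)"
        using True qI by (simp add: renyi_div_def Let_def su)
      have "Max ((\<lambda>i. elog base (entry u i / entry p i)) ` I) \<in> (\<lambda>i. elog base (entry u i / entry p i)) ` I"
        using finI I by (intro Max_in) auto
      then obtain i where i: "i \<in> I" "Max ((\<lambda>i. elog base (entry u i / entry p i)) ` I) = elog base (entry u i / entry p i)"
        by blast
      have "lentry p i < lentry q j" if j: "j \<in> vsupp q" for j
      proof -
        have pos: "0 < entry q j" "0 < entry p i" using prob_vec_entry_pos p q j i(1) True by auto
        have "elog base (entry u j / entry q j) < elog base (entry u i / entry p i)"
          using less finI I(1) j qI unfolding i(2) by simp
        then have "log base (1 / (d * entry q j)) < log base (1 / (d * entry p i))"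
          using pos j qI i(1) d by (simp add: elog_def eu)
        then show ?thesis using pos d base by (simp add: log_divide)
      qed
      then show ?thesis using i(1) True by blast
    qed
    moreover have "card (vsupp p) = card (vsupp q)" using True qI by simp
    ultimately show ?thesis by (intro disjI2 conjI allI impI)
  qed
  have "\<forall>\<^sub>F n in sequentially. \<forall>\<tau>. hinge (vsupp q) (\<lambda>_. 1) (lentry q) n \<tau> \<le> hinge (vsupp p) (\<lambda>_. 1) (lentry p) n \<tau>"
    by (rule hinge_le_hinge_eventually)
      (use p q power_sum_1 vsupp_nonempty gt1 btw ent max low in \<open>simp_all add: power_sum_deriv_0 power_sum_deriv_1\<close>)
  moreover have "\<forall>\<^sub>F n in sequentially. 0 < (n :: nat)" by (rule eventually_gt_at_top)
  ultimately show ?thesis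
    by eventually_elim (rule majorizes_kron_power_if_hinge_le[OF p q])
qed

end
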